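(* Let $n=2r+1$ be odd ($r\ge1$) and $\ell\in\{1,r+1,n\}$. The $\mathcal U_q(sl_{n+1}^{tor})$-module $V(e^{\varpi_\ell}Y_{\ell,0}Y_{0,d_\ell}^{-1})$ is an extremal loop weight module generated by the vector $v_{e^{\varpi_\ell}Y_{\ell,0}Y_{0,d_\ell}^{-1}}$, which has $\ell$-weight $e^{\varpi_\ell}Y_{\ell,0}Y_{0,d_\ell}^{-1}$.
   Context: Root data. Let $n=2r+1$, $r\ge1$, $I=\{0,\dots,n\}$ identified with $\mathbb Z/(n+1)\mathbb Z$, $C=(C_{i,j})_{i,j\in I}$ the Cartan matrix of type $A_n^{(1)}$ ($C_{i,i}=2$, $C_{i,i\pm1}=-1$, other entries $0$), $\mathfrak h=\bigoplus_{i\in I}\mathbb Q h_i\oplus\mathbb Q d$; $\alpha_i(h_j)=C_{j,i}$, $\alpha_i(d)=\delta_{0,i}$, $\Lambda_i(h_j)=\delta_{i,j}$, $\Lambda_i(d)=0$; $P=\{\lambda\in\mathfrak h^*:\lambda(h_i)\in\mathbb Z\ \forall i\}$, $\varpi_\ell=\Lambda_\ell-\Lambda_0$, $d_\ell=\min(\ell,n+1-\ell)$. $W$ is the affine Weyl group generated by $s_i(\lambda)=\lambda-\lambda(h_i)\alpha_i$, $i\in I$. Fix $q=e^t\in\mathbb C^*$ not a root of unity, $q^x=e^{tx}$ for $x\in\mathbb Q$, $[l]_q=\frac{q^l-q^{-l}}{q-q^{-1}}$. Monomial crystal. Consider monomials $m=e^{\omega(m)}\prod_{i\in I,l\in\mathbb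 Z}Y_{i,l}^{u_{i,l}(m)}$ with $u_{i,l}(m)\in\mathbb Z$ (finitely many non-zero), $\omega(m)\in P$, $\sum_l u_{i,l}(m)=\omega(m)(h_i)$. Put $A_{i,l}=e^{\alpha_i}Y_{i,l-1}Y_{i,l+1}Y_{i-1,l}^{-1}Y_{i+1,l}^{-1}$. Fix $s:I\to\{0,1\}$ with $s_i+s_j=1$ whenever $C_{i,j}=-1$ (chosen so that the monomials considered lie in $\mathcal M$); $\mathcal M$ is the group of monomials with $u_{i,l}(m)=0$ whenever $l\equiv s_i+1\bmod 2$. Set $\mathrm{wt}(m)=\omega(m)$, $\varphi_{i,L}(m)=\sum_{l\le L}u_{i,l}(m)$, $\varphi_i(m)=\max_L\varphi_{i,L}(m)$, $\varepsilon_{i,L}(m)=-\sum_{l\ge L}u_{i,l}(m)$, $\varepsilon_i(m)=\max_L\varepsilon_{i,L}(m)$, $p_i(m)=\max\{L:\varepsilon_{i,L}(m)=\varepsilon_i(m)\}$, $q_i(m)=\min\{L:\varphi_{i,L}(m)=\varphi_i(m)\}$; $\tilde e_i\cdot m=0$ if $\varepsilon_i(m)=0$, else $\tilde e_i\cdot m=mA_{i,p_i(m)-1}$; $\tilde f_i\cdot m=0$ if $\varphi_i(m)=0$, else $\tilde f_i\cdot m=mA_{i,q_i(m)+1}^{-1}$. $\mathcal M(m)$ is the connected subcrystal generated by $m$. Quantum toroidal algebra. $\mathcal U_q(sl_{n+1}^{tor})$ is the $\mathbb C$-algebra with generators $x_{i,r}^\pm$ ($i\in I,r\in\mathbb Z$),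 $k_h$ ($h\in\mathfrak h$), $h_{i,m}$ ($i\in I,m\in\mathbb Z\setminus\{0\}$) and relations: $k_hk_{h'}=k_{h+h'}$, $k_0=1$, $[k_h,h_{j,m}]=0$, $[h_{i,m},h_{j,m'}]=0$; $k_hx_{j,r}^\pm k_{-h}=q^{\pm\alpha_j(h)}x_{j,r}^\pm$; $[h_{i,m},x_{j,r}^\pm]=\pm\frac1m[mC_{i,j}]_qx_{j,m+r}^\pm$; $[x_{i,r}^+,x_{j,r'}^-]=\delta_{ij}\frac{\phi^+_{i,r+r'}-\phi^-_{i,r+r'}}{q-q^{-1}}$; $x_{i,r+1}^\pm x_{j,r'}^\pm-q^{\pm C_{ij}}x_{j,r'}^\pm x_{i,r+1}^\pm=q^{\pm C_{ij}}x_{i,r}^\pm x_{j,r'+1}^\pm-x_{j,r'+1}^\pm x_{i,r}^\pm$; for $j=i+1$ and $j=i-1$ the expression $x_{i,r_1}^\pm x_{i,r_2}^\pm x_{j,r'}^\pm-(q+q^{-1})x_{i,r_1}^\pm x_{j,r'}^\pm x_{i,r_2}^\pm+x_{j,r'}^\pm x_{i,r_1}^\pm x_{i,r_2}^\pm$ plus the same expression with $r_1,r_2$ exchanged is $0$; $[x_{i,r_1}^\pm,x_{j,r_2}^\pm]=0$ if $i\ne j,j\pm1$. Here $\phi_i^\pm(z)=\sum_{m\ge0}\phi^\pm_{i,\pm m}z^{\pm m}=k_{h_i}^{\pm1}\exp\big(\pm(q-q^{-1})\sum_{m'\ge1}h_{i,\pm m'}z^{\pm m'}\big)$ and $\phi^+_{i,m}=0$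 for $m<0$, $\phi^-_{i,m}=0$ for $m>0$. The horizontal subalgebra $\mathcal U_q^h(sl_{n+1}^{tor})$, image of $\mathcal U_q(\widehat{sl}_{n+1})$, is generated by the $x_i^\pm:=x_{i,0}^\pm$ and $k_h$. For $j\in I$, $\mathcal U_q^{v,j}(sl_{n+1}^{tor})$ is the subalgebra generated by $x_{i,r}^\pm$, $h_{i,m}$ ($i\in I\setminus\{j\}$) and $k_h$ ($h\in\bigoplus_{i\ne j}\mathbb Qh_i$). Representations. $V_\nu=\{v:k_hv=q^{\nu(h)}v\ \forall h\in\mathfrak h\}$ for $\nu\in P$; $V$ is integrable if $V=\bigoplus_{\nu\in P}V_\nu$ and all $x_{i,0}^\pm$ are locally nilpotent. A vector $v\in V_{\omega(m)}$ is an $\ell$-weight vector of $\ell$-weight $m$ if for each $i$, $\phi_i^\pm(z)$ acts on $v$ with (generalized) eigenvalue the expansion in $z^{\pm1}$ of $\prod_l\big(q\frac{1-zq^{l-1}}{1-zq^{l+1}}\big)^{u_{i,l}(m)}$. A vector $v$ of weight $\lambda$ is extremal (for $\mathcal U_q^h(sl_{n+1}^{tor})$) if there are vectors $(v_w)_{w\in W}$ with $v_{\mathrm{Id}}=v$ and, whenever $\pm w(\lambda)(h_i)\ge0$, $x_i^\pm v_w=0$ and $(x_i^\mp)^{(\pm w(\lambda)(h_i))}v_w=v_{s_iw}$, where $x^{(k)}=x^k/([k]_q[k-1]_q\cdots[1]_q)$. An extremal loop weight module is an integrable representation $V$ with an $\ell$-weight vector $v$ such that (i) $\mathcal U_q(sl_{n+1}^{tor})\cdot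 v=V$, (ii) $v$ is extremal for $\mathcal U_q^h(sl_{n+1}^{tor})$, (iii) $\mathcal U_q^{v,j}(sl_{n+1}^{tor})\cdot w$ is finite-dimensional for all $w\in V$, $j\in I$; one says $V$ is generated by $v$. The module. For $\ell\in\{1,r+1,n\}$, $V(e^{\varpi_\ell}Y_{\ell,0}Y_{0,d_\ell}^{-1})$ is the $\mathcal U_q(sl_{n+1}^{tor})$-module with basis $(v_m)$ indexed by the monomials $m$ of $\mathcal M(e^{\varpi_\ell}Y_{\ell,0}Y_{0,d_\ell}^{-1})$ determined by: $k_hv_m=q^{\mathrm{wt}(m)(h)}v_m$; $\phi_i^\pm(z)$ acts on $v_m$ by the scalar series attached to $m$ above; $x_{i,0}^+v_m=v_{\tilde e_i\cdot m}$ and $x_{i,0}^-v_m=v_{\tilde f_i\cdot m}$, with $v_0:=0$. (These data determine the action of all $x_{i,r}^\pm$ through the relation for $[h_{i,m},x_{i,0}^\pm]$; such a module exists for these $\ell$.) *)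

theory Defs
  imports
    "HOL-Algebra.QuotRing"
    "HOL-Library.Poly_Mapping"
    "HOL-Library.Product_Plus"
    "HOL-Computational_Algebra.Formal_Power_Series"
begin

section \<open>Root data\<close>

text \<open>The index set \<open>I = {0..n}\<close> is identified with the integers modulo \<open>n + 1\<close>;
  \<open>nxt n i\<close> and \<open>prv n i\<close> are \<open>i + 1\<close> and \<open>i - 1\<close> in \<open>I\<close>. The Cartan matrix is the one of type
  \<open>A_n^(1)\<close> for \<open>n \<ge> 2\<close>.\<close>

definition nxt :: "nat \<Rightarrow> nat \<Rightarrow> nat" where
  "nxt n i = (i + 1) mod (n + 1)"

definition prv :: "nat \<Rightarrow> nat \<Rightarrow> nat" where
  "prv n i = (i + n) mod (n + 1)"

definition Cartan :: "nat \<Rightarrow> nat \<Rightarrow> nat \<Rightarrow> int" where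
  "Cartan n i j = (if i = j then 2 else if j = nxt n i \<or> j = prv n i then - 1 else 0)"

text \<open>\<open>CH i\<close> and \<open>CD\<close> label the basis vectors \<open>h_i\<close> and \<open>d\<close> of \<open>\<hh>\<close>. Elements of \<open>\<hh>\<close> are given by their
  coordinates in this basis and elements of the dual space \<open>\<hh>*\<close> by their values on it.\<close>

datatype cbasis = CH nat | CD

type_synonym cvec = "cbasis \<Rightarrow>\<^sub>0 rat"

definition cartan_space :: "nat \<Rightarrow> cvec set" where
  "cartan_space n = {h. Poly_Mapping.keys h \<subseteq> insert CD (CH ` {0..n})}"

definition hvec :: "nat \<Rightarrow> cvec" where
  "hvec i = Poly_Mapping.single (CH i) 1"

definition pairing :: "cvec \<Rightarrow> cvec \<Rightarrow> rat" where
  "pairing \<mu> h = (\<Sum>b\<in>Poly_Mapping.keys h. Poly_Mapping.lookup \<mu> b * Poly_Mapping.lookup h b)"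

definition sroot :: "nat \<Rightarrow> nat \<Rightarrow> cvec" where
  "sroot n i = (\<Sum>j\<in>{0..n}. Poly_Mapping.single (CH j) (of_int (Cartan n j i)))
              + Poly_Mapping.single CD (if i = 0 then 1 else 0)"

definition Lam :: "nat \<Rightarrow> cvec" where
  "Lam i = Poly_Mapping.single (CH i) 1"

definition varpi :: "nat \<Rightarrow> cvec" where
  "varpi l = Lam l - Lam 0"

definition weight_lattice :: "nat \<Rightarrow> cvec set" where
  "weight_lattice n = {\<mu>. Poly_Mapping.keys \<mu> \<subseteq> insert CD (CH ` {0..n}) \<and> (\<forall>i\<in>{0..n}. pairing \<mu> (hvec i) \<in> \<int>)}"

definition sref :: "nat \<Rightarrow> nat \<Rightarrow> cvec \<Rightarrow> cvec" where
  "sref n i \<mu> = \<mu> - Poly_Mapping.map (\<lambda>c. pairing \<mu> (hvec i) * c) (sroot n i)"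

text \<open>The simple reflections are involutions, so closing under them yields the group they generate.\<close>

inductive_set affine_weyl :: "nat \<Rightarrow> (cvec \<Rightarrow> cvec) set" for n where
  one: "id \<in> affine_weyl n"
| refl: "w \<in> affine_weyl n \<Longrightarrow> i \<in> {0..n} \<Longrightarrow> sref n i \<circ> w \<in> affine_weyl n"

text \<open>\<open>q = e^t\<close>, \<open>q^x = e^(tx)\<close>\<close>

definition qpow :: "complex \<Rightarrow> rat \<Rightarrow> complex" where
  "qpow t x = exp (t * of_rat x)"

definition qint :: "complex \<Rightarrow> int \<Rightarrow> complex" where
  "qint t k = (qpow t (of_int k) - qpow t (- of_int k)) / (qpow t 1 - qpow t (- 1))"


section \<open>The monomial crystal\<close>

text \<open>A monomial \<open>e^\<omega> \<Prod> Y_{i,l}^{u_{i,l}}\<close> is the pair of \<open>\<omega>\<close> and the exponent family \<open>u\<close>;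
  the group of monomials is thereby written additively.\<close>

type_synonym monomial = "cvec \<times> (nat \<times> int \<Rightarrow>\<^sub>0 int)"

definition uexp :: "monomial \<Rightarrow> nat \<Rightarrow> int \<Rightarrow> int" where
  "uexp m i l = Poly_Mapping.lookup (snd m) (i, l)"

definition wt :: "monomial \<Rightarrow> cvec" where
  "wt m = fst m"

definition expo :: "cvec \<Rightarrow> monomial" where
  "expo \<mu> = (\<mu>, 0)"

definition Yvar :: "nat \<Rightarrow> int \<Rightarrow> monomial" where
  "Yvar i l = (0, Poly_Mapping.single (i, l) 1)"

definition Avar :: "nat \<Rightarrow> nat \<Rightarrow> int \<Rightarrow> monomial" where
  "Avar n i l = expo (sroot n i) + Yvar i (l - 1) + Yvar i (l + 1) - Yvar (prv n i) l - Yvar (nxt n i) l"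

definition is_monomial :: "nat \<Rightarrow> monomial \<Rightarrow> bool" where
  "is_monomial n m \<longleftrightarrow>
     wt m \<in> weight_lattice n \<and> Poly_Mapping.keys (snd m) \<subseteq> {0..n} \<times> UNIV \<and>
     (\<forall>i\<in>{0..n}. of_int (\<Sum>l | uexp m i l \<noteq> 0. uexp m i l) = pairing (wt m) (hvec i))"

definition parity_function :: "nat \<Rightarrow> (nat \<Rightarrow> nat) \<Rightarrow> bool" where
  "parity_function n s \<longleftrightarrow>
     (\<forall>i\<in>{0..n}. s i \<in> {0, 1}) \<and>
     (\<forall>i\<in>{0..n}. \<forall>j\<in>{0..n}. Cartan n i j = - 1 \<longrightarrow> s i + s j = 1)"

definition crystal_monomials :: "nat \<Rightarrow> (nat \<Rightarrow> nat) \<Rightarrow> monomial set" where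
  "crystal_monomials n s =
     {m. is_monomial n m \<and>
         (\<forall>i\<in>{0..n}. \<forall>l. l mod 2 = (int (s i) + 1) mod 2 \<longrightarrow> uexp m i l = 0)}"

definition phiL :: "nat \<Rightarrow> int \<Rightarrow> monomial \<Rightarrow> int" where
  "phiL i L m = (\<Sum>l | l \<le> L \<and> uexp m i l \<noteq> 0. uexp m i l)"

definition epsL :: "nat \<Rightarrow> int \<Rightarrow> monomial \<Rightarrow> int" where
  "epsL i L m = - (\<Sum>l | l \<ge> L \<and> uexp m i l \<noteq> 0. uexp m i l)"

definition phimax :: "nat \<Rightarrow> monomial \<Rightarrow> int" where
  "phimax i m = Max (range (\<lambda>L. phiL i L m))"

definition epsmax :: "nat \<Rightarrow> monomial \<Rightarrow> int" where
  "epsmax i m = Max (range (\<lambda>L. epsL i L m))"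

definition ppos :: "nat \<Rightarrow> monomial \<Rightarrow> int" where
  "ppos i m = (GREATEST L. epsL i L m = epsmax i m)"

definition qpos :: "nat \<Rightarrow> monomial \<Rightarrow> int" where
  "qpos i m = (LEAST L. phiL i L m = phimax i m)"

text \<open>\<open>None\<close> is the value \<open>0\<close> of the crystal operators.\<close>

definition etil :: "nat \<Rightarrow> nat \<Rightarrow> monomial \<Rightarrow> monomial option" where
  "etil n i m = (if epsmax i m = 0 then None else Some (m + Avar n i (ppos i m - 1)))"

definition ftil :: "nat \<Rightarrow> nat \<Rightarrow> monomial \<Rightarrow> monomial option" where
  "ftil n i m = (if phimax i m = 0 then None else Some (m - Avar n i (qpos i m + 1)))"

inductive_set subcrystal :: "nat \<Rightarrow> monomial \<Rightarrow> monomial set" for n m0 where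
  start: "m0 \<in> subcrystal n m0"
| etil: "m \<in> subcrystal n m0 \<Longrightarrow> i \<in> {0..n} \<Longrightarrow> etil n i m = Some m' \<Longrightarrow> m' \<in> subcrystal n m0"
| ftil: "m \<in> subcrystal n m0 \<Longrightarrow> i \<in> {0..n} \<Longrightarrow> ftil n i m = Some m' \<Longrightarrow> m' \<in> subcrystal n m0"


section \<open>Free algebras\<close>

text \<open>The free algebra on \<open>'g\<close> is the monoid algebra over \<open>\<complex>\<close> of the free monoid of words in \<open>'g\<close>.
  Words are wrapped so that concatenation can be the \<open>+\<close> underlying the convolution product.\<close>

datatype 'g fword = FWord (letters: "'g list")

instantiation fword :: (type) monoid_add
begin

definition zero_fword :: "'a fword" where "zero_fword = FWord []"

definition plus_fword :: "'a fword \<Rightarrow> 'a fword \<Rightarrow> 'a fword" where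
  "plus_fword v w = FWord (letters v @ letters w)"

instance
  by standard (simp_all add: zero_fword_def plus_fword_def)

end

type_synonym 'g falg = "'g fword \<Rightarrow>\<^sub>0 complex"

definition con :: "complex \<Rightarrow> 'g falg" where
  "con c = Poly_Mapping.single 0 c"

definition gen :: "'g \<Rightarrow> 'g falg" where
  "gen g = Poly_Mapping.single (FWord [g]) 1"

definition free_algebra :: "'g set \<Rightarrow> 'g falg ring" where
  "free_algebra G =
     \<lparr>carrier = {a. \<forall>w\<in>Poly_Mapping.keys a. set (letters w) \<subseteq> G}, monoid.mult = (*), one = 1, zero = 0, add = (+)\<rparr>"

lemma ring_free_algebra: "ring (free_algebra G)"
proof (rule ringI)
  show "abelian_group (free_algebra G)"
  proof (rule abelian_groupI)
    fix x y assume "x \<in> carrier (free_algebra G)" "y \<in> carrier (free_algebra G)"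
    then show "x \<oplus>\<^bsub>free_algebra G\<^esub> y \<in> carrier (free_algebra G)"
      using Poly_Mapping.keys_add[of x y] by (auto simp: free_algebra_def)
  next
    fix x assume "x \<in> carrier (free_algebra G)"
    then show "\<exists>y\<in>carrier (free_algebra G). y \<oplus>\<^bsub>free_algebra G\<^esub> x = \<zero>\<^bsub>free_algebra G\<^esub>"
      by (intro bexI[of _ "- x"]) (auto simp: free_algebra_def)
  qed (auto simp: free_algebra_def algebra_simps)
  show "Group.monoid (free_algebra G)"
  proof (rule Group.monoidI)
    fix x y assume "x \<in> carrier (free_algebra G)" "y \<in> carrier (free_algebra G)"
    then show "x \<otimes>\<^bsub>free_algebra G\<^esub> y \<in> carrier (free_algebra G)"
      using Poly_Mapping.keys_mult[of x y] by (fastforce simp: free_algebra_def plus_fword_def)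
  qed (auto simp: free_algebra_def mult.assoc zero_fword_def)
qed (auto simp: free_algebra_def algebra_simps)


section \<open>The quantum toroidal algebra\<close>

datatype pm = Pl | Mi

fun sg :: "pm \<Rightarrow> 'a::{one, uminus}" where
  "sg Pl = 1"
| "sg Mi = - 1"

datatype qgen = Xg pm nat int | Kg cvec | Hg nat int

definition qtor_gens :: "nat \<Rightarrow> qgen set" where
  "qtor_gens n = {Xg s i m | s i m. i \<in> {0..n}} \<union> {Kg h | h. h \<in> cartan_space n}
               \<union> {Hg i m | i m. i \<in> {0..n} \<and> m \<noteq> 0}"

abbreviation xx :: "pm \<Rightarrow> nat \<Rightarrow> int \<Rightarrow> qgen falg" where
  "xx s i m \<equiv> gen (Xg s i m)"

abbreviation kk :: "cvec \<Rightarrow> qgen falg" where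
  "kk h \<equiv> gen (Kg h)"

abbreviation hh :: "nat \<Rightarrow> int \<Rightarrow> qgen falg" where
  "hh i m \<equiv> gen (Hg i m)"

definition commut :: "qgen falg \<Rightarrow> qgen falg \<Rightarrow> qgen falg" where
  "commut a b = a * b - b * a"

text \<open>Coefficient of \<open>z^m\<close> in \<open>exp F\<close>, for a series \<open>F\<close> without constant term and with coefficients in
  a free algebra; the powers \<open>F^k\<close> with \<open>k > m\<close> do not contribute.\<close>

definition exp_coeff :: "'g falg fps \<Rightarrow> nat \<Rightarrow> 'g falg" where
  "exp_coeff F m = (\<Sum>k\<le>m. con (1 / fact k) * fps_nth (F ^ k) m)"

text \<open>\<open>phi t s i m\<close> is \<open>\<phi>^s_{i,m}\<close>, with \<open>m\<close> the exponent of \<open>z\<close>.\<close>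

definition phi :: "complex \<Rightarrow> pm \<Rightarrow> nat \<Rightarrow> int \<Rightarrow> qgen falg" where
  "phi t s i m =
     (if sg s * m < 0 then 0
      else (case s of Pl \<Rightarrow> kk (hvec i) | Mi \<Rightarrow> kk (- hvec i)) *
           exp_coeff (Abs_fps (\<lambda>a. if a = 0 then 0
              else con (sg s * (qpow t 1 - qpow t (- 1))) * hh i (sg s * int a))) (nat \<bar>m\<bar>))"

definition serre :: "complex \<Rightarrow> pm \<Rightarrow> nat \<Rightarrow> nat \<Rightarrow> int \<Rightarrow> int \<Rightarrow> int \<Rightarrow> qgen falg" where
  "serre t s i j a b c =
     xx s i a * xx s i b * xx s j c
     - con (qpow t 1 + qpow t (- 1)) * (xx s i a * xx s j c * xx s i b)
     + xx s j c * xx s i a * xx s i b"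

text \<open>Each relation \<open>L = R\<close> is represented by the element \<open>L - R\<close> of the free algebra.\<close>

inductive_set qtor_rels :: "nat \<Rightarrow> complex \<Rightarrow> qgen falg set" for n t where
  k_add: "h \<in> cartan_space n \<Longrightarrow> h' \<in> cartan_space n \<Longrightarrow>
    kk h * kk h' - kk (h + h') \<in> qtor_rels n t"
| k_zero: "kk 0 - 1 \<in> qtor_rels n t"
| k_h: "h \<in> cartan_space n \<Longrightarrow> j \<in> {0..n} \<Longrightarrow> m \<noteq> 0 \<Longrightarrow>
    commut (kk h) (hh j m) \<in> qtor_rels n t"
| h_h: "i \<in> {0..n} \<Longrightarrow> j \<in> {0..n} \<Longrightarrow> m \<noteq> 0 \<Longrightarrow> m' \<noteq> 0 \<Longrightarrow>
    commut (hh i m) (hh j m') \<in> qtor_rels n t"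
| k_x: "h \<in> cartan_space n \<Longrightarrow> j \<in> {0..n} \<Longrightarrow>
    kk h * xx s j a * kk (- h) - con (qpow t (sg s * pairing (sroot n j) h)) * xx s j a \<in> qtor_rels n t"
| h_x: "i \<in> {0..n} \<Longrightarrow> j \<in> {0..n} \<Longrightarrow> m \<noteq> 0 \<Longrightarrow>
    commut (hh i m) (xx s j a)
    - con (sg s * (1 / of_int m) * qint t (m * Cartan n i j)) * xx s j (m + a) \<in> qtor_rels n t"
| x_x: "i \<in> {0..n} \<Longrightarrow> j \<in> {0..n} \<Longrightarrow>
    commut (xx Pl i a) (xx Mi j b)
    - (if i = j then con (1 / (qpow t 1 - qpow t (- 1))) * (phi t Pl i (a + b) - phi t Mi i (a + b)) else 0)
    \<in> qtor_rels n t"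
| quadratic: "i \<in> {0..n} \<Longrightarrow> j \<in> {0..n} \<Longrightarrow> Q = con (qpow t (sg s * of_int (Cartan n i j))) \<Longrightarrow>
    (xx s i (a + 1) * xx s j b - Q * (xx s j b * xx s i (a + 1)))
    - (Q * (xx s i a * xx s j (b + 1)) - xx s j (b + 1) * xx s i a) \<in> qtor_rels n t"
| serre: "i \<in> {0..n} \<Longrightarrow> j = nxt n i \<or> j = prv n i \<Longrightarrow>
    serre t s i j a b c + serre t s i j b a c \<in> qtor_rels n t"
| distant: "i \<in> {0..n} \<Longrightarrow> j \<in> {0..n} \<Longrightarrow> i \<noteq> j \<Longrightarrow> i \<noteq> nxt n j \<Longrightarrow> i \<noteq> prv n j \<Longrightarrow>
    commut (xx s i a) (xx s j b) \<in> qtor_rels n t"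

type_synonym qtor_elem = "qgen falg set"

definition qtor_ideal :: "nat \<Rightarrow> complex \<Rightarrow> qgen falg set" where
  "qtor_ideal n t = genideal (free_algebra (qtor_gens n)) (qtor_rels n t)"

definition qtor :: "nat \<Rightarrow> complex \<Rightarrow> qtor_elem ring" where
  "qtor n t = free_algebra (qtor_gens n) Quot qtor_ideal n t"

definition cls :: "nat \<Rightarrow> complex \<Rightarrow> qgen falg \<Rightarrow> qtor_elem" where
  "cls n t a = qtor_ideal n t +>\<^bsub>free_algebra (qtor_gens n)\<^esub> a"

text \<open>The (unital) subalgebra generated by a set of elements.\<close>

inductive_set subalgebra :: "nat \<Rightarrow> complex \<Rightarrow> qtor_elem set \<Rightarrow> qtor_elem set" for n t S where
  scalar: "cls n t (con c) \<in> subalgebra n t S"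
| gener: "a \<in> S \<Longrightarrow> a \<in> subalgebra n t S"
| add: "a \<in> subalgebra n t S \<Longrightarrow> b \<in> subalgebra n t S \<Longrightarrow> a \<oplus>\<^bsub>qtor n t\<^esub> b \<in> subalgebra n t S"
| mult: "a \<in> subalgebra n t S \<Longrightarrow> b \<in> subalgebra n t S \<Longrightarrow> a \<otimes>\<^bsub>qtor n t\<^esub> b \<in> subalgebra n t S"

definition vertical :: "nat \<Rightarrow> complex \<Rightarrow> nat \<Rightarrow> qtor_elem set" where
  "vertical n t j = subalgebra n t
     ({cls n t (xx s i a) | s i a. i \<in> {0..n} - {j}}
      \<union> {cls n t (hh i m) | i m. i \<in> {0..n} - {j} \<and> m \<noteq> 0}
      \<union> {cls n t (kk h) | h. Poly_Mapping.keys h \<subseteq> CH ` ({0..n} - {j})})"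

definition divided_power :: "nat \<Rightarrow> complex \<Rightarrow> qtor_elem \<Rightarrow> nat \<Rightarrow> qtor_elem" where
  "divided_power n t x k =
     cls n t (con (1 / (\<Prod>a\<in>{1..k}. qint t (int a)))) \<otimes>\<^bsub>qtor n t\<^esub> (x [^]\<^bsub>qtor n t\<^esub> k)"


section \<open>Representations\<close>

text \<open>Left modules: \<open>scale\<close> is the complex vector space structure on the type \<open>'v\<close> and \<open>act\<close> the action.\<close>

definition qtor_module ::
  "nat \<Rightarrow> complex \<Rightarrow> (complex \<Rightarrow> 'v \<Rightarrow> 'v::ab_group_add) \<Rightarrow> (qtor_elem \<Rightarrow> 'v \<Rightarrow> 'v) \<Rightarrow> bool" where
  "qtor_module n t scale act \<longleftrightarrow>
     vector_space scale \<and>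
     (\<forall>a\<in>carrier (qtor n t). Vector_Spaces.linear scale scale (act a)) \<and>
     (\<forall>c v. act (cls n t (con c)) v = scale c v) \<and>
     (\<forall>a\<in>carrier (qtor n t). \<forall>b\<in>carrier (qtor n t). \<forall>v.
        act (a \<oplus>\<^bsub>qtor n t\<^esub> b) v = act a v + act b v \<and>
        act (a \<otimes>\<^bsub>qtor n t\<^esub> b) v = act a (act b v))"

definition weight_space ::
  "nat \<Rightarrow> complex \<Rightarrow> (complex \<Rightarrow> 'v \<Rightarrow> 'v::ab_group_add) \<Rightarrow> (qtor_elem \<Rightarrow> 'v \<Rightarrow> 'v) \<Rightarrow> cvec \<Rightarrow> 'v set" where
  "weight_space n t scale act \<nu> =
     {v. \<forall>h\<in>cartan_space n. act (cls n t (kk h)) v = scale (qpow t (pairing \<nu> h)) v}"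

text \<open>The first conjunct says \<open>V = \<Oplus>\<^sub>\<nu> V\<^sub>\<nu>\<close>, the sum being over \<open>\<nu> \<in> P\<close>.\<close>

definition integrable ::
  "nat \<Rightarrow> complex \<Rightarrow> (complex \<Rightarrow> 'v \<Rightarrow> 'v::ab_group_add) \<Rightarrow> (qtor_elem \<Rightarrow> 'v \<Rightarrow> 'v) \<Rightarrow> bool" where
  "integrable n t scale act \<longleftrightarrow>
     (\<forall>v. \<exists>!f. (\<forall>\<nu>\<in>weight_lattice n. f \<nu> \<in> weight_space n t scale act \<nu>) \<and>
               (\<forall>\<nu>. \<nu> \<notin> weight_lattice n \<longrightarrow> f \<nu> = 0) \<and>
               finite {\<nu>. f \<nu> \<noteq> 0} \<and> v = (\<Sum>\<nu> | f \<nu> \<noteq> 0. f \<nu>)) \<and>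
     (\<forall>s. \<forall>i\<in>{0..n}. \<forall>v. \<exists>k. (act (cls n t (xx s i 0)) ^^ k) v = 0)"

text \<open>Expansions of \<open>q (1 - z q^(l-1)) / (1 - z q^(l+1))\<close> in \<open>z\<close> (for \<open>Pl\<close>) and in \<open>1/z\<close> (for \<open>Mi\<close>).
  In the second case \<open>fps_X\<close> stands for \<open>1/z\<close> and the fraction has been expanded by \<open>1/z\<close>.\<close>

definition Y_series :: "complex \<Rightarrow> pm \<Rightarrow> int \<Rightarrow> complex fps" where
  "Y_series t s l = (case s of
     Pl \<Rightarrow> fps_const (qpow t 1) * (1 - fps_const (qpow t (of_int (l - 1))) * fps_X)
           * inverse (1 - fps_const (qpow t (of_int (l + 1))) * fps_X)
   | Mi \<Rightarrow> fps_const (qpow t 1) * (fps_X - fps_const (qpow t (of_int (l - 1))))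
           * inverse (fps_X - fps_const (qpow t (of_int (l + 1)))))"

definition lweight_series :: "complex \<Rightarrow> pm \<Rightarrow> nat \<Rightarrow> monomial \<Rightarrow> complex fps" where
  "lweight_series t s i m = (\<Prod>l | uexp m i l \<noteq> 0. Y_series t s l powi uexp m i l)"

definition lweight_vector ::
  "nat \<Rightarrow> complex \<Rightarrow> (complex \<Rightarrow> 'v \<Rightarrow> 'v::ab_group_add) \<Rightarrow> (qtor_elem \<Rightarrow> 'v \<Rightarrow> 'v) \<Rightarrow> 'v \<Rightarrow> monomial \<Rightarrow> bool"
  where
  "lweight_vector n t scale act v m \<longleftrightarrow>
     is_monomial n m \<and> v \<noteq> 0 \<and> v \<in> weight_space n t scale act (wt m) \<and>
     (\<exists>p. \<forall>s. \<forall>i\<in>{0..n}. \<forall>a::nat.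
        ((\<lambda>u. act (cls n t (phi t s i (sg s * int a))) u
              - scale (fps_nth (lweight_series t s i m) a) u) ^^ p) v = 0)"

text \<open>The family \<open>u\<close> is \<open>(v_w)\<close>. The pairings of \<open>w \<mu>\<close> with \<open>h_i\<close> are integers for \<open>\<mu> \<in> P\<close>, so that the floor
  only serves to convert types.\<close>

definition extremal ::
  "nat \<Rightarrow> complex \<Rightarrow> (complex \<Rightarrow> 'v \<Rightarrow> 'v::ab_group_add) \<Rightarrow> (qtor_elem \<Rightarrow> 'v \<Rightarrow> 'v) \<Rightarrow> 'v \<Rightarrow> bool" where
  "extremal n t scale act v \<longleftrightarrow>
     (\<exists>\<mu>\<in>weight_lattice n. v \<in> weight_space n t scale act \<mu> \<and>
       (\<exists>u :: (cvec \<Rightarrow> cvec) \<Rightarrow> 'v. u id = v \<and>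
         (\<forall>w\<in>affine_weyl n. \<forall>i\<in>{0..n}.
           (pairing (w \<mu>) (hvec i) \<ge> 0 \<longrightarrow>
              act (cls n t (xx Pl i 0)) (u w) = 0 \<and>
              act (divided_power n t (cls n t (xx Mi i 0)) (nat \<lfloor>pairing (w \<mu>) (hvec i)\<rfloor>)) (u w)
                = u (sref n i \<circ> w)) \<and>
           (- pairing (w \<mu>) (hvec i) \<ge> 0 \<longrightarrow>
              act (cls n t (xx Mi i 0)) (u w) = 0 \<and>
              act (divided_power n t (cls n t (xx Pl i 0)) (nat \<lfloor>- pairing (w \<mu>) (hvec i)\<rfloor>)) (u w)
                = u (sref n i \<circ> w)))))"

definition extremal_loop_weight_module ::
  "nat \<Rightarrow> complex \<Rightarrow> (complex \<Rightarrow> 'v \<Rightarrow> 'v::ab_group_add) \<Rightarrow> (qtor_elem \<Rightarrow> 'v \<Rightarrow> 'v) \<Rightarrow> 'v \<Rightarrow> bool" where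
  "extremal_loop_weight_module n t scale act v \<longleftrightarrow>
     qtor_module n t scale act \<and> integrable n t scale act \<and>
     (\<exists>m. lweight_vector n t scale act v m) \<and>
     {act a v | a. a \<in> carrier (qtor n t)} = UNIV \<and>
     extremal n t scale act v \<and>
     (\<forall>w. \<forall>j\<in>{0..n}. \<exists>B. finite B \<and> {act a w | a. a \<in> vertical n t j} = module.span scale B)"

text \<open>The module \<open>V(m0)\<close> with its distinguished basis \<open>b\<close>; \<open>ovec b\<close> extends \<open>b\<close> by \<open>v_0 = 0\<close>.\<close>

definition ovec :: "(monomial \<Rightarrow> 'v::zero) \<Rightarrow> monomial option \<Rightarrow> 'v" where
  "ovec b x = (case x of None \<Rightarrow> 0 | Some m \<Rightarrow> b m)"

definition monomial_module ::
  "nat \<Rightarrow> complex \<Rightarrow> (complex \<Rightarrow> 'v \<Rightarrow> 'v::ab_group_add) \<Rightarrow> (qtor_elem \<Rightarrow> 'v \<Rightarrow> 'v) \<Rightarrow>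
   monomial \<Rightarrow> (monomial \<Rightarrow> 'v) \<Rightarrow> bool" where
  "monomial_module n t scale act m0 b \<longleftrightarrow>
     qtor_module n t scale act \<and>
     inj_on b (subcrystal n m0) \<and>
     \<not> module.dependent scale (b ` subcrystal n m0) \<and>
     module.span scale (b ` subcrystal n m0) = UNIV \<and>
     (\<forall>m\<in>subcrystal n m0.
        (\<forall>h\<in>cartan_space n. act (cls n t (kk h)) (b m) = scale (qpow t (pairing (wt m) h)) (b m)) \<and>
        (\<forall>i\<in>{0..n}.
          (\<forall>s. \<forall>a::nat. act (cls n t (phi t s i (sg s * int a))) (b m)
                          = scale (fps_nth (lweight_series t s i m) a) (b m)) \<and>
          act (cls n t (xx Pl i 0)) (b m) = ovec b (etil n i m) \<and>
          act (cls n t (xx Mi i 0)) (b m) = ovec b (ftil n i m)))"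

definition dnum :: "nat \<Rightarrow> nat \<Rightarrow> nat" where
  "dnum n l = min l (n + 1 - l)"

definition fund_monomial :: "nat \<Rightarrow> nat \<Rightarrow> monomial" where
  "fund_monomial n l = expo (varpi l) + Yvar l 0 - Yvar 0 (int (dnum n l))"

end

theory Submission
  imports Defs
begin

text \<open>The three modules are extremal loop weight modules because their crystals are minuscule. In
  every monomial of the crystal each node \<open>i\<close> carries at most one variable \<open>Y_{i,l}\<close>, with
  exponent \<open>1\<close> or \<open>- 1\<close>, and a monomial is determined by its weight. Consequently the non-zero
  weight spaces are lines, every \<open>x_{i,0}\<close> squares to zero, and \<open>s_i\<close> acts on the weights of the
  crystal by following the single arrow of colour \<open>i\<close>, if there is one, so that the weights of the
  crystal contain the Weyl orbit of the weight of the generator. Taking for \<open>v_w\<close> the basis vector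
  of weight \<open>w \<lambda>\<close> gives an extremal family (\<open>extremal\<close>), and cyclicity holds since the arrows
  connect the crystal (\<open>cyclic\<close>).

  For the finiteness over \<open>U^{v,j}\<close> two observations combine. The \<open>h_{i,m}\<close> are diagonal in the
  basis \<open>(v_m)\<close>, being polynomials in the coefficients of \<open>\<phi>_i(z)\<close> and \<open>k\<close> (\<open>hh_diagonal\<close>), and
  \<open>[h_{i,m}, x_{i,0}]\<close> is a non-zero multiple of \<open>x_{i,m}\<close> because \<open>q\<close> is not a root of unity; so
  the vertical subalgebra preserves the span of any part of the crystal that is closed under the
  arrows of colour different from \<open>j\<close>. Such a part is finite when generated by one monomial \<open>m\<close>:
  its weights are \<open>wt m + \<Sum>\<^sub>i c_i \<alpha>_i\<close> with \<open>c_j = 0\<close>, they take only the values \<open>- 1, 0, 1\<close> on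
  the \<open>h_i\<close>, and these values determine \<open>c\<close>, since a vector in the kernel of the affine Cartan
  matrix is constant and hence vanishes if its \<open>j\<close>-th entry does (\<open>finite_colour_block\<close>).

  That the crystals are minuscule is seen from explicit models. For \<open>l = 1\<close> and \<open>l = n\<close> the
  crystal is the bi-infinite path of the monomials \<open>Y_{k+1,k} Y_{k,k+1}^{-1}\<close>, with the nodes read
  modulo \<open>n + 1\<close> in one of the two orientations of the cycle (\<open>minuscule_boxes\<close>). For \<open>l = r + 1\<close>
  its elements are encoded by height functions: integer functions \<open>H\<close> on the cycle whose values at
  adjacent nodes differ by one. Node \<open>i\<close> carries \<open>Y_{i,H(i)}\<close> if \<open>H\<close> has a local minimum there and
  \<open>Y_{i,H(i)}^{-1}\<close> if it has a local maximum, and \<open>f_i\<close> turns a local minimum \<open>H(i)\<close> into the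
  local maximum \<open>H(i) + 2\<close> (\<open>minuscule_heights\<close>).\<close>

section \<open>The affine Cartan matrix\<close>

lemma nxt_eq: "i \<le> n \<Longrightarrow> nxt n i = (if i = n then 0 else i + 1)"
  by (simp add: nxt_def)

lemma prv_eq: "i \<le> n \<Longrightarrow> prv n i = (if i = 0 then n else i - 1)"
proof -
  assume "i \<le> n"
  have "(i + n) mod (n + 1) = i - 1" if "i \<noteq> 0"
  proof -
    have "(i + n) mod (n + 1) = ((i - 1) + (n + 1)) mod (n + 1)" using that by simp
    also have "\<dots> = i - 1" unfolding mod_add_self2 using \<open>i \<le> n\<close> by simp
    finally show ?thesis .
  qed
  then show ?thesis by (auto simp: prv_def)
qed

lemma lookup_sroot:
  assumes "i \<le> n"
  shows "Poly_Mapping.lookup (sroot n i) (CH j) = (if j \<le> n then of_int (Cartan n j i) else 0)"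
    and "Poly_Mapping.lookup (sroot n i) CD = (if i = 0 then 1 else 0)"
  using assms
  by (auto simp: sroot_def lookup_add Poly_Mapping.lookup_sum lookup_single when_def)

lemma neighbours_distinct:
  assumes "n \<ge> 2" "i \<le> n"
  shows "nxt n i \<noteq> prv n i" "nxt n i \<noteq> i" "prv n i \<noteq> i" "nxt n i \<le> n" "prv n i \<le> n"
  using assms by (auto simp: nxt_eq prv_eq)

lemma nxt_eq_iff_prv:
  assumes "i \<le> n" "j \<le> n"
  shows "j = nxt n i \<longleftrightarrow> i = prv n j"
  using assms by (auto simp: nxt_eq prv_eq)

lemma Cartan_sym: "i \<le> n \<Longrightarrow> j \<le> n \<Longrightarrow> Cartan n i j = Cartan n j i"
  using nxt_eq_iff_prv[of i n j] nxt_eq_iff_prv[of j n i] by (auto simp: Cartan_def)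

lemma sroot_eq:
  assumes "n \<ge> 2" "i \<le> n"
  shows "sroot n i = Poly_Mapping.single (CH i) 2 - Poly_Mapping.single (CH (nxt n i)) 1
    - Poly_Mapping.single (CH (prv n i)) 1 + Poly_Mapping.single CD (if i = 0 then 1 else 0)"
proof (rule poly_mapping_eqI)
  fix c
  have d: "nxt n i \<noteq> prv n i" "nxt n i \<noteq> i" "prv n i \<noteq> i" "nxt n i \<le> n" "prv n i \<le> n"
    using neighbours_distinct[OF assms] by auto
  show "Poly_Mapping.lookup (sroot n i) c = Poly_Mapping.lookup (Poly_Mapping.single (CH i) 2 -
      Poly_Mapping.single (CH (nxt n i)) 1
    - Poly_Mapping.single (CH (prv n i)) 1 + Poly_Mapping.single CD (if i = 0 then 1 else 0)) c"
  proof (cases c)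
    case (CH j)
    have "Cartan n j i = (if i = j then 2 else if j = nxt n i \<or> j = prv n i then - 1 else 0)" if "j \<le> n"
      using Cartan_sym[OF assms(2) that] by (auto simp: Cartan_def)
    then show ?thesis
      using d assms(2) by (auto simp: CH lookup_sroot(1) lookup_add lookup_minus lookup_single when_def)
  next
    case CD
    then show ?thesis
      by (simp add: lookup_sroot(2)[OF assms(2)] lookup_add lookup_minus lookup_single)
  qed
qed

lemma pairing_hvec [simp]: "pairing \<mu> (hvec i) = Poly_Mapping.lookup \<mu> (CH i)"
  by (simp add: pairing_def hvec_def)

text \<open>The increments of a harmonic function are all equal, and going once around the cycle they
  add up to zero. In other words the kernel of the affine Cartan matrix consists of the constant
  vectors.\<close>

lemma periodic_harmonic_imp_constant:
  fixes E :: "nat \<Rightarrow> rat"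
  assumes "\<And>i. i \<le> n \<Longrightarrow> E (nxt n i) + E (prv n i) = 2 * E i" and "i \<le> n"
  shows "E i = E 0"
proof -
  define D where "D = E 0 - E n"
  have "E i = E 0 + of_nat i * D" if "i \<le> n" for i
    using that
  proof (induction i rule: less_induct)
    case (less i)
    consider "i = 0" | "i = 1" | k where "i = Suc (Suc k)"
      by (metis One_nat_def not0_implies_Suc)
    then show ?case
    proof cases
      case 2
      then show ?thesis using assms(1)[of 0] less.prems by (simp add: nxt_eq prv_eq D_def)
    next
      case 3
      then show ?thesis using assms(1)[of "Suc k"] less.prems less.IH[of k] less.IH[of "Suc k"]
        by (simp add: nxt_eq prv_eq algebra_simps)
    qed simp
  qed
  from this[of n] this[OF \<open>i \<le> n\<close>] have "(of_nat n + 1) * D = 0" "E i = E 0 + of_nat i * D"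
    by (simp_all add: D_def algebra_simps)
  moreover from this(1) have "D = 0"
    using of_nat_0_le_iff[of n, where ?'a = rat] by (simp add: add_nonneg_eq_0_iff)
  ultimately show ?thesis by simp
qed

lemma sum_Cartan:
  assumes "n \<ge> 2" "i \<le> n"
  shows "(\<Sum>k\<in>{0..n}. f k * of_int (Cartan n i k)) = 2 * f i - f (nxt n i) - (f (prv n i) :: rat)"
proof -
  have d: "nxt n i \<noteq> prv n i" "nxt n i \<noteq> i" "prv n i \<noteq> i" "nxt n i \<le> n" "prv n i \<le> n"
    using neighbours_distinct[OF assms] by auto
  have "(\<Sum>k\<in>{0..n}. f k * of_int (Cartan n i k)) = (\<Sum>k\<in>{i, nxt n i, prv n i}. f k * of_int (Cartan n
      i k))"
    using assms d by (intro sum.mono_neutral_right) (auto simp: Cartan_def)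
  also have "\<dots> = 2 * f i - f (nxt n i) - f (prv n i)"
    using d by (simp add: Cartan_def)
  finally show ?thesis .
qed

section \<open>Minuscule crystals\<close>

text \<open>The next three lemmas compute the crystal operators at a node that carries at most one
  variable. The operator \<open>f_i\<close> then exchanges \<open>Y_{i,L}\<close> for \<open>Y_{i,L+2}^{-1}\<close>, and \<open>e_i\<close> does the
  reverse.\<close>

lemma string_trivial:
  assumes "\<And>l. uexp m i l = 0"
  shows "etil n i m = None" "ftil n i m = None"
  by (simp_all add: etil_def ftil_def epsmax_def phimax_def epsL_def phiL_def assms)

lemma string_plus:
  assumes u: "\<And>l. uexp m i l = (if l = L then 1 else 0)"
  shows "etil n i m = None" "ftil n i m = Some (m - Avar n i (L + 1))"
proof -
  have s: "{l. P l \<and> uexp m i l \<noteq> 0} = (if P L then {L} else {})" for P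
    by (auto simp: u)
  have phi: "phiL i K m = (if L \<le> K then 1 else 0)" for K
    by (simp add: phiL_def s u)
  have eps: "epsL i K m = (if K \<le> L then - 1 else 0)" for K
    by (simp add: epsL_def s u)
  have "range (\<lambda>K. phiL i K m) = {0, 1}"
    using rangeI[of "\<lambda>K. phiL i K m" L] rangeI[of "\<lambda>K. phiL i K m" "L - 1"]
    by (auto simp only: phi) (auto split: if_splits)
  then have p: "phimax i m = 1" by (simp add: phimax_def)
  have "range (\<lambda>K. epsL i K m) = {0, -1}"
    using rangeI[of "\<lambda>K. epsL i K m" L] rangeI[of "\<lambda>K. epsL i K m" "L + 1"]
    by (auto simp only: eps) (auto split: if_splits)
  then have e: "epsmax i m = 0" by (simp add: epsmax_def)
  have "qpos i m = L"
    unfolding qpos_def p by (rule Least_equality) (auto simp: phi split: if_splits)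
  then show "etil n i m = None" "ftil n i m = Some (m - Avar n i (L + 1))"
    by (simp_all add: etil_def ftil_def p e)
qed

lemma string_minus:
  assumes u: "\<And>l. uexp m i l = (if l = L then - 1 else 0)"
  shows "ftil n i m = None" "etil n i m = Some (m + Avar n i (L - 1))"
proof -
  have s: "{l. P l \<and> uexp m i l \<noteq> 0} = (if P L then {L} else {})" for P
    by (auto simp: u)
  have phi: "phiL i K m = (if L \<le> K then - 1 else 0)" for K
    by (simp add: phiL_def s u)
  have eps: "epsL i K m = (if K \<le> L then 1 else 0)" for K
    by (simp add: epsL_def s u)
  have "range (\<lambda>K. phiL i K m) = {0, - 1}"
    using rangeI[of "\<lambda>K. phiL i K m" L] rangeI[of "\<lambda>K. phiL i K m" "L - 1"]
    by (auto simp only: phi) (auto split: if_splits)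
  then have p: "phimax i m = 0" by (simp add: phimax_def)
  have "range (\<lambda>K. epsL i K m) = {0, 1}"
    using rangeI[of "\<lambda>K. epsL i K m" L] rangeI[of "\<lambda>K. epsL i K m" "L + 1"]
    by (auto simp only: eps) (auto split: if_splits)
  then have e: "epsmax i m = 1" by (simp add: epsmax_def)
  have "ppos i m = L"
    unfolding ppos_def e by (rule Greatest_equality) (auto simp: eps split: if_splits)
  then show "ftil n i m = None" "etil n i m = Some (m + Avar n i (L - 1))"
    by (simp_all add: etil_def ftil_def p e)
qed

lemma wt_simps: "wt (m + m') = wt m + wt m'" "wt (m - m') = wt m - wt m'" "wt (Avar n i l) = sroot n i"
  by (simp_all add: wt_def Avar_def expo_def Yvar_def)

text \<open>Only weights and arrows are recorded: this is all that the representation theory below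
  needs, and closedness under the arrows is part of the definition. The three alternatives say
  that each colour string has length at most one, with the length read off from the weight.\<close>

definition minuscule_crystal :: "nat \<Rightarrow> monomial set \<Rightarrow> bool" where
  "minuscule_crystal n X \<longleftrightarrow> inj_on wt X \<and>
     (\<forall>m\<in>X. wt m \<in> weight_lattice n \<and> (\<forall>i\<in>{0..n}.
        pairing (wt m) (hvec i) = 0 \<and> etil n i m = None \<and> ftil n i m = None
      \<or> pairing (wt m) (hvec i) = 1 \<and> etil n i m = None \<and>
          (\<exists>m'\<in>X. ftil n i m = Some m' \<and> wt m' = wt m - sroot n i)
      \<or> pairing (wt m) (hvec i) = - 1 \<and> ftil n i m = None \<and>
          (\<exists>m'\<in>X. etil n i m = Some m' \<and> wt m' = wt m + sroot n i)))"

text \<open>The arrows are read off from the exponents, so that closedness only has to be checked for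
  the multiplications by \<open>A_{i,L+1}^{-1}\<close> and \<open>A_{i,L-1}\<close>.\<close>

lemma minuscule_crystalI:
  assumes "inj_on wt X" and "\<And>m. m \<in> X \<Longrightarrow> wt m \<in> weight_lattice n"
    and "\<And>m i. m \<in> X \<Longrightarrow> i \<le> n \<Longrightarrow>
        pairing (wt m) (hvec i) = 0 \<and> (\<forall>l. uexp m i l = 0)
      \<or> pairing (wt m) (hvec i) = 1 \<and> (\<exists>L. (\<forall>l. uexp m i l = (if l = L then 1 else 0))
          \<and> m - Avar n i (L + 1) \<in> X)
      \<or> pairing (wt m) (hvec i) = - 1 \<and> (\<exists>L. (\<forall>l. uexp m i l = (if l = L then - 1 else 0))
          \<and> m + Avar n i (L - 1) \<in> X)"
  shows "minuscule_crystal n X"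
  unfolding minuscule_crystal_def
proof (intro conjI ballI)
  fix m i assume m: "m \<in> X" and i: "i \<in> {0..n}"
  from assms(3)[OF m, of i] i
  consider "pairing (wt m) (hvec i) = 0" "\<And>l. uexp m i l = 0"
    | L where "pairing (wt m) (hvec i) = 1" "\<And>l. uexp m i l = (if l = L then 1 else 0)"
        "m - Avar n i (L + 1) \<in> X"
    | L where "pairing (wt m) (hvec i) = - 1" "\<And>l. uexp m i l = (if l = L then - 1 else 0)"
        "m + Avar n i (L - 1) \<in> X"
    by auto
  then show "pairing (wt m) (hvec i) = 0 \<and> etil n i m = None \<and> ftil n i m = None
      \<or> pairing (wt m) (hvec i) = 1 \<and> etil n i m = None \<and>
          (\<exists>m'\<in>X. ftil n i m = Some m' \<and> wt m' = wt m - sroot n i)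
      \<or> pairing (wt m) (hvec i) = - 1 \<and> ftil n i m = None \<and>
          (\<exists>m'\<in>X. etil n i m = Some m' \<and> wt m' = wt m + sroot n i)"
  proof cases
    case 1
    then show ?thesis using string_trivial by blast
  next
    case 2
    then show ?thesis using string_plus[OF 2(2), of n] by (auto simp: wt_simps)
  next
    case 3
    then show ?thesis using string_minus[OF 3(2), of n] by (auto simp: wt_simps)
  qed
qed (use assms in auto)

text \<open>A set that is closed under the arrows contains the connected component of each of its
  elements, and the component inherits all properties. So it suffices to find a minuscule set of
  monomials around \<open>m0\<close>.\<close>

lemma minuscule_subcrystal:
  assumes X: "minuscule_crystal n X" and m0: "m0 \<in> X"
  shows "minuscule_crystal n (subcrystal n m0)"
proof -
  have sub: "m \<in> X" if "m \<in> subcrystal n m0" for m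
    using that
  proof induction
    case (etil m i m')
    then show ?case using X unfolding minuscule_crystal_def by fastforce
  next
    case (ftil m i m')
    then show ?case using X unfolding minuscule_crystal_def by fastforce
  qed (rule m0)
  then have "inj_on wt (subcrystal n m0)"
    using X unfolding minuscule_crystal_def by (blast intro: inj_on_subset)
  then show ?thesis
    using X sub unfolding minuscule_crystal_def
    by (blast intro: subcrystal.etil subcrystal.ftil)
qed

section \<open>Blocks of a crystal without one colour\<close>

text \<open>The elements of \<open>X\<close> whose weight differs from that of \<open>m\<close> by a combination of the simple
  roots other than \<open>\<alpha>_j\<close>. This contains every element that can be reached from \<open>m\<close> by arrows of
  colour different from \<open>j\<close> and, unlike reachability, it can be tested on weights.\<close>

definition colour_block :: "nat \<Rightarrow> monomial set \<Rightarrow> nat \<Rightarrow> monomial \<Rightarrow> monomial set" where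
  "colour_block n X j m = {m' \<in> X. \<exists>c. c j = 0 \<and> (\<forall>x. Poly_Mapping.lookup (wt m') x =
       Poly_Mapping.lookup (wt m) x + (\<Sum>i\<in>{0..n}. c i * Poly_Mapping.lookup (sroot n i) x))}"

lemma colour_block_self: "m \<in> X \<Longrightarrow> m \<in> colour_block n X j m"
  unfolding colour_block_def by (auto intro!: exI[of _ "\<lambda>_. 0"])

text \<open>Following an arrow of colour \<open>i\<close> only changes the coefficient \<open>c_i\<close>.\<close>

lemma colour_block_step:
  assumes m': "m' \<in> colour_block n X j m" and "i \<le> n" "i \<noteq> j" "m'' \<in> X"
    and w: "wt m'' = wt m' + sroot n i \<or> wt m'' = wt m' - sroot n i"
  shows "m'' \<in> colour_block n X j m"
proof -
  obtain c where c: "c j = 0" "\<And>x. Poly_Mapping.lookup (wt m') x =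
       Poly_Mapping.lookup (wt m) x + (\<Sum>i\<in>{0..n}. c i * Poly_Mapping.lookup (sroot n i) x)"
    using m' by (auto simp: colour_block_def)
  obtain e :: rat where e: "\<And>x. Poly_Mapping.lookup (wt m'') x
      = Poly_Mapping.lookup (wt m') x + e * Poly_Mapping.lookup (sroot n i) x"
    using w by (elim disjE) (auto simp: lookup_add lookup_minus intro: that[of 1] that[of "- 1"])
  define c' where "c' k = c k + (if k = i then e else 0)" for k
  have "(\<Sum>k\<in>{0..n}. c' k * y k) = (\<Sum>k\<in>{0..n}. c k * y k) + e * y i" for y
    using assms(2) by (simp add: c'_def distrib_right sum.distrib if_distrib[of
        "\<lambda>a. a * _"] cong: if_cong)
  then show ?thesis unfolding colour_block_def using assms(3,4) c e
    by (auto intro!: exI[of _ c'] simp: c'_def)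
qed

text \<open>The values on the \<open>h_i\<close> separate the elements of a block: two weights of the block with the
  same values differ by a combination of simple roots whose coefficients are harmonic on the cycle
  and vanish at \<open>j\<close>. In a minuscule crystal there are finitely many possibilities for these
  values.\<close>

lemma finite_colour_block:
  assumes X: "minuscule_crystal n X" and n: "n \<ge> 2" and j: "j \<le> n"
  shows "finite (colour_block n X j m)"
proof -
  define g where "g m i = (if i \<le> n then Poly_Mapping.lookup (wt m) (CH i) else 0)" for m i
  have "Poly_Mapping.lookup (wt m) (CH i) \<in> {- 1, 0, 1}" if "m \<in> X" "i \<le> n" for m i
    using X that unfolding minuscule_crystal_def by fastforce
  then have "g m' i \<in> {- 1, 0, 1}" if "m' \<in> X" "i \<in> {0..n}" for m' i
    using that by (simp add: g_def)
  moreover have "colour_block n X j m \<subseteq> X" by (auto simp: colour_block_def)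
  moreover have "g m' i = 0" if "i \<notin> {0..n}" for m' i using that by (simp add: g_def)
  ultimately have "g ` colour_block n X j m
      \<subseteq> {f. \<forall>i. (i \<in> {0..n} \<longrightarrow> f i \<in> {- 1, 0, 1}) \<and> (i \<notin> {0..n} \<longrightarrow> f i = 0)}"
    by blast
  then have "finite (g ` colour_block n X j m)"
    by (rule finite_subset) (intro finite_set_of_finite_funs; simp)
  moreover have "inj_on g (colour_block n X j m)"
  proof (rule inj_onI)
    fix p p' assume p: "p \<in> colour_block n X j m" "p' \<in> colour_block n X j m" and g: "g p = g p'"
    obtain c c' where c: "c j = 0" "\<And>x. Poly_Mapping.lookup (wt p) x =
         Poly_Mapping.lookup (wt m) x + (\<Sum>i\<in>{0..n}. c i * Poly_Mapping.lookup (sroot n i) x)"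
      and c': "c' j = 0" "\<And>x. Poly_Mapping.lookup (wt p') x =
         Poly_Mapping.lookup (wt m) x + (\<Sum>i\<in>{0..n}. c' i * Poly_Mapping.lookup (sroot n i) x)"
      using p unfolding colour_block_def by blast
    define E where "E i = c i - c' i" for i
    have "E (nxt n i) + E (prv n i) = 2 * E i" if i: "i \<le> n" for i
    proof -
      have "Poly_Mapping.lookup (wt p) (CH i) = Poly_Mapping.lookup (wt p') (CH i)"
        using fun_cong[OF g, of i] i by (simp add: g_def)
      then have "(\<Sum>k\<in>{0..n}. c k * of_int (Cartan n i k)) = (\<Sum>k\<in>{0..n}. c' k * of_int (Cartan n i k))"
        using i by (simp add: c c' lookup_sroot)
      then show ?thesis unfolding sum_Cartan[OF n i] E_def by simp
    qed
    then have const: "E i = E 0" if "i \<le> n" for i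
      using periodic_harmonic_imp_constant that by blast
    have "E i = 0" if "i \<le> n" for i
      using const[OF that] const[OF j] c(1) c'(1) by (simp add: E_def)
    then have "wt p = wt p'"
      by (intro poly_mapping_eqI) (auto simp: c c' E_def intro!: sum.cong)
    then show "p = p'"
      using X p unfolding minuscule_crystal_def colour_block_def by (auto dest: inj_onD)
  qed
  ultimately show ?thesis by (rule finite_imageD)
qed

section \<open>Paths of boxes on the cycle\<close>

text \<open>\<open>\<sigma> = 1\<close> and \<open>\<sigma> = - 1\<close> are the two orientations of the cycle.\<close>

definition box_node :: "nat \<Rightarrow> int \<Rightarrow> int \<Rightarrow> nat" where
  "box_node n \<sigma> k = nat ((\<sigma> * k) mod (int n + 1))"

text \<open>The \<open>k\<close>-th monomial on the bi-infinite path of the arrows \<open>f_i\<close>, the fundamental monomial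
  being number \<open>0\<close>. Colour \<open>0\<close> is used once in each turn of the cycle, which is why \<open>d\<close> takes the
  value \<open>- (k div (n + 1))\<close> on its weight.\<close>

definition box :: "nat \<Rightarrow> int \<Rightarrow> int \<Rightarrow> monomial" where
  "box n \<sigma> k = expo (Lam (box_node n \<sigma> (k + 1)) - Lam (box_node n \<sigma> k)
       - Poly_Mapping.single CD (of_int (k div (int n + 1))))
     + Yvar (box_node n \<sigma> (k + 1)) k - Yvar (box_node n \<sigma> k) (k + 1)"

lemma box_node_le: "box_node n \<sigma> k \<le> n"
  unfolding box_node_def using pos_mod_bound[of "int n + 1" "\<sigma> * k"] by linarith

lemma box_node_eq_iff:
  assumes "\<sigma> = 1 \<or> \<sigma> = - 1"
  shows "box_node n \<sigma> k = box_node n \<sigma> k' \<longleftrightarrow> k mod (int n + 1) = k' mod (int n + 1)"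
proof -
  have "box_node n \<sigma> k = box_node n \<sigma> k' \<longleftrightarrow> (\<sigma> * k) mod (int n + 1) = (\<sigma> * k') mod (int n + 1)"
    by (simp add: box_node_def eq_nat_nat_iff)
  also have "\<dots> \<longleftrightarrow> k mod (int n + 1) = k' mod (int n + 1)"
    using assms dvd_minus_iff[of "int n + 1" "k - k'"] by (auto simp: mod_eq_dvd_iff)
  finally show ?thesis .
qed

lemma int_nxt: "i \<le> n \<Longrightarrow> int (nxt n i) = (int i + 1) mod (int n + 1)"
  by (simp add: nxt_def zmod_int add.commute)

lemma int_prv: "i \<le> n \<Longrightarrow> int (prv n i) = (int i - 1) mod (int n + 1)"
proof -
  have "int (prv n i) = (int i - 1 + (int n + 1)) mod (int n + 1)"
    by (simp add: prv_def zmod_int add.commute)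
  then show ?thesis by (simp only: mod_add_self2)
qed

lemma int_box_node: "int (box_node n \<sigma> k) = (\<sigma> * k) mod (int n + 1)"
  by (simp add: box_node_def)

lemma box_node_neighbours:
  "nxt n (box_node n 1 k) = box_node n 1 (k + 1)" "prv n (box_node n 1 k) = box_node n 1 (k - 1)"
  "nxt n (box_node n (- 1) k) = box_node n (- 1) (k - 1)" "prv n (box_node n (- 1) k)
      = box_node n (- 1) (k + 1)"
proof -
  have eqs: "int (nxt n (box_node n \<sigma> k)) = (\<sigma> * k + 1) mod (int n + 1)"
       "int (prv n (box_node n \<sigma> k)) = (\<sigma> * k - 1) mod (int n + 1)" for \<sigma>
    by (simp_all add: int_nxt int_prv box_node_le int_box_node mod_add_left_eq mod_diff_left_eq)
  have "int (nxt n (box_node n 1 k)) = int (box_node n 1 (k + 1))"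
       "int (prv n (box_node n 1 k)) = int (box_node n 1 (k - 1))"
       "int (nxt n (box_node n (- 1) k)) = int (box_node n (- 1) (k - 1))"
       "int (prv n (box_node n (- 1) k)) = int (box_node n (- 1) (k + 1))"
    unfolding eqs by (simp_all add: int_box_node)
  then show "nxt n (box_node n 1 k) = box_node n 1 (k + 1)" "prv n (box_node n 1 k)
      = box_node n 1 (k - 1)"
    "nxt n (box_node n (- 1) k) = box_node n (- 1) (k - 1)" "prv n (box_node n (- 1) k)
        = box_node n (- 1) (k + 1)"
    by linarith+
qed

lemma div_succ:
  fixes k N :: int
  assumes "N > 0"
  shows "(k + 1) div N = k div N + (if (k + 1) mod N = 0 then 1 else 0)"
proof -
  define q r where "q = (k + 1) div N" and "r = (k + 1) mod N"
  have k: "k + 1 = N * q + r" "0 \<le> r" "r < N"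
    using assms by (simp_all add: q_def r_def)
  have "k div N = q - (if r = 0 then 1 else 0)"
    using k by (intro int_div_pos_eq[where r = "if r
        = 0 then N - 1 else r - 1"]) (auto simp: algebra_simps)
  then show ?thesis by (simp flip: q_def r_def)
qed

lemma box_step:
  assumes "\<sigma> = 1 \<or> \<sigma> = - 1" "n \<ge> 2"
  shows "box n \<sigma> k - Avar n (box_node n \<sigma> (k + 1)) (k + 1) = box n \<sigma> (k + 1)"
proof -
  let ?i = "box_node n \<sigma> (k + 1)"
  have nb: "Lam (nxt n ?i) + Lam (prv n ?i) = Lam (box_node n \<sigma> k) + Lam (box_node n \<sigma> (k + 2))"
       "Yvar (nxt n ?i) l + Yvar (prv n ?i) l = Yvar (box_node n \<sigma> k) l + Yvar (box_node n \<sigma> (k +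
           2)) l" for l
    using assms(1) by (auto simp: box_node_neighbours algebra_simps)
  have z: "?i = 0 \<longleftrightarrow> (k + 1) mod (int n + 1) = 0"
    using box_node_eq_iff[OF assms(1), of n "k + 1" 0] by (simp add: box_node_def)
  have dv: "(k + 1) div (int n + 1) = k div (int n + 1) + (if ?i = 0 then 1 else 0)"
    using div_succ[of "int n + 1" k] by (simp add: z)
  have sr: "sroot n ?i = Lam ?i + Lam ?i - (Lam (box_node n \<sigma> k) + Lam (box_node n \<sigma> (k + 2)))
      + Poly_Mapping.single CD (if ?i = 0 then 1 else 0)"
    unfolding sroot_eq[OF assms(2) box_node_le] nb[symmetric]
    by (simp add: Lam_def flip: single_add)
  have A: "Avar n ?i (k + 1) = expo (sroot n ?i) + Yvar ?i k + Yvar ?i (k + 2)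
      - (Yvar (box_node n \<sigma> k) (k + 1) + Yvar (box_node n \<sigma> (k + 2)) (k + 1))"
    unfolding nb(2)[symmetric] by (simp add: Avar_def add.commute)
  have two: "k + 1 + 1 = k + 2" by simp
  show ?thesis
    unfolding box_def A dv prod_eq_iff two
    by (simp add: expo_def Yvar_def sr single_diff single_add)
qed

lemma box_step':
  assumes "\<sigma> = 1 \<or> \<sigma> = - 1" "n \<ge> 2"
  shows "box n \<sigma> k + Avar n (box_node n \<sigma> k) k = box n \<sigma> (k - 1)"
  using box_step[OF assms, of "k - 1"] by (simp add: diff_eq_eq)

lemma box_node_Suc_neq:
  assumes "\<sigma> = 1 \<or> \<sigma> = - 1" "n \<ge> 1"
  shows "box_node n \<sigma> (k + 1) \<noteq> box_node n \<sigma> k"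
proof
  assume "box_node n \<sigma> (k + 1) = box_node n \<sigma> k"
  then have "(int n + 1) dvd 1"
    by (simp add: box_node_eq_iff[OF assms(1)] mod_eq_dvd_iff)
  then show False using assms(2) by simp
qed

lemma lookup_wt_box:
  "Poly_Mapping.lookup (wt (box n \<sigma> k)) (CH i) =
     (if i = box_node n \<sigma> (k + 1) then 1 else 0) - (if i = box_node n \<sigma> k then 1 else 0)"
  "Poly_Mapping.lookup (wt (box n \<sigma> k)) CD = - of_int (k div (int n + 1))"
  by (auto simp: box_def wt_def expo_def Yvar_def Lam_def lookup_minus lookup_single when_def)

lemma uexp_box:
  "uexp (box n \<sigma> k) i l = (if i = box_node n \<sigma> (k + 1) \<and> l = k then 1 else 0)
     - (if i = box_node n \<sigma> k \<and> l = k + 1 then 1 else 0)"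
  by (auto simp: uexp_def box_def expo_def Yvar_def lookup_minus lookup_single when_def)

text \<open>The value on \<open>d\<close> gives the quotient of \<open>k\<close> by \<open>n + 1\<close>, the node with the value \<open>- 1\<close> gives
  the remainder.\<close>

lemma inj_wt_box:
  assumes \<sigma>: "\<sigma> = 1 \<or> \<sigma> = - 1" and n: "n \<ge> 1" and eq: "wt (box n \<sigma> k) = wt (box n \<sigma> k')"
  shows "k = k'"
proof -
  have "k div (int n + 1) = k' div (int n + 1)"
    using arg_cong[OF eq, of "\<lambda>\<mu>. Poly_Mapping.lookup \<mu> CD"] by (simp add: lookup_wt_box)
  moreover have "box_node n \<sigma> k = box_node n \<sigma> k'"
    using arg_cong[OF eq, of "\<lambda>\<mu>. Poly_Mapping.lookup \<mu> (CH (box_node n \<sigma> k))"]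
      box_node_Suc_neq[OF \<sigma> n, of k]
    by (auto simp: lookup_wt_box split: if_splits)
  then have "k mod (int n + 1) = k' mod (int n + 1)"
    by (simp add: box_node_eq_iff[OF \<sigma>])
  ultimately show ?thesis by (metis mult_div_mod_eq)
qed

lemma minuscule_boxes:
  assumes \<sigma>: "\<sigma> = 1 \<or> \<sigma> = - 1" and n: "n \<ge> 2"
  shows "minuscule_crystal n (range (box n \<sigma>))"
proof (rule minuscule_crystalI)
  show "inj_on wt (range (box n \<sigma>))"
    using inj_wt_box[OF \<sigma>, of n] n by (force simp: inj_on_def)
next
  fix m assume "m \<in> range (box n \<sigma>)"
  then obtain k where m: "m = box n \<sigma> k" by auto
  have "c \<in> insert CD (CH ` {0..n})" if "Poly_Mapping.lookup (wt m) c \<noteq> 0" for c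
    using that box_node_le[of n \<sigma> k] box_node_le[of n \<sigma> "k + 1"]
    by (cases c) (auto simp: m lookup_wt_box split: if_splits)
  then show "wt m \<in> weight_lattice n"
    by (auto simp: weight_lattice_def in_keys_iff m lookup_wt_box)
  fix i
  have ne: "box_node n \<sigma> (k + 1) \<noteq> box_node n \<sigma> k"
    using box_node_Suc_neq[OF \<sigma>] n by simp
  consider "i = box_node n \<sigma> (k + 1)" | "i = box_node n \<sigma> k"
    | "i \<noteq> box_node n \<sigma> (k + 1)" "i \<noteq> box_node n \<sigma> k" by blast
  then show "pairing (wt m) (hvec i) = 0 \<and> (\<forall>l. uexp m i l = 0)
      \<or> pairing (wt m) (hvec i) = 1 \<and> (\<exists>L. (\<forall>l. uexp m i l = (if l = L then 1 else 0))
          \<and> m - Avar n i (L + 1) \<in> range (box n \<sigma>))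
      \<or> pairing (wt m) (hvec i) = - 1 \<and> (\<exists>L. (\<forall>l. uexp m i l = (if l = L then - 1 else 0))
          \<and> m + Avar n i (L - 1) \<in> range (box n \<sigma>))"
  proof cases
    case 1
    then show ?thesis using ne
      by (intro disjI2 disjI1 conjI exI[of _ k])
        (auto simp: m lookup_wt_box uexp_box box_step[OF \<sigma> n])
  next
    case 2
    then show ?thesis using ne
      by (intro disjI2 conjI exI[of _ "k + 1"])
        (auto simp: m lookup_wt_box uexp_box box_step'[OF \<sigma> n])
  next
    case 3
    then show ?thesis by (simp add: m lookup_wt_box uexp_box)
  qed
qed

lemma fund_monomial_eq_box:
  assumes "n \<ge> 1"
  shows "fund_monomial n 1 = box n 1 0" "fund_monomial n n = box n (- 1) 0"
proof -
  have "(- 1) mod (int n + 1) = int n"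
    using assms by (simp add: zmod_minus1)
  with assms show "fund_monomial n 1 = box n 1 0" "fund_monomial n n = box n (- 1) 0"
    by (simp_all add: fund_monomial_def box_def box_node_def varpi_def dnum_def)
qed

section \<open>Height functions on the cycle\<close>

text \<open>Half of the second difference of \<open>H\<close> on the cycle. If \<open>H\<close> has steps \<open>\<plusminus> 1\<close>, it is \<open>1\<close> at
  local minima, \<open>- 1\<close> at local maxima, and \<open>0\<close> elsewhere.\<close>

definition second_diff :: "nat \<Rightarrow> (nat \<Rightarrow> int) \<Rightarrow> nat \<Rightarrow> int" where
  "second_diff n H i = (H (nxt n i) + H (prv n i) - 2 * H i) div 2"

text \<open>Raising \<open>H 0\<close> by \<open>2\<close> is an application of \<open>f_0\<close> and lowers the value of the weight on \<open>d\<close> by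
  one, whence the coefficient of \<open>CD\<close>; \<open>c\<close> is the height of node \<open>0\<close> at which this value is zero.\<close>

definition height_monomial :: "nat \<Rightarrow> rat \<Rightarrow> (nat \<Rightarrow> int) \<Rightarrow> monomial" where
  "height_monomial n c H =
     ((\<Sum>i\<in>{0..n}. Poly_Mapping.single (CH i) (of_int (second_diff n H i))) + Poly_Mapping.single CD
         ((c - of_int (H 0)) / 2),
      \<Sum>i\<in>{0..n}. Poly_Mapping.single (i, H i) (second_diff n H i))"

definition unit_steps :: "nat \<Rightarrow> (nat \<Rightarrow> int) \<Rightarrow> bool" where
  "unit_steps n H \<longleftrightarrow> (\<forall>i\<le>n. \<bar>H (nxt n i) - H i\<bar> = 1)"

lemma unit_steps_prv: "unit_steps n H \<Longrightarrow> i \<le> n \<Longrightarrow> \<bar>H (prv n i) - H i\<bar> = 1"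
  using nxt_eq_iff_prv[of "prv n i" n i] unfolding unit_steps_def
  by (metis abs_minus_commute le_add1 mod_less_divisor less_Suc_eq_le Suc_eq_plus1 prv_def
      zero_less_Suc)

lemma lookup_height_monomial:
  "Poly_Mapping.lookup (wt (height_monomial n c H)) (CH i)
      = (if i \<le> n then of_int (second_diff n H i) else 0)"
  "Poly_Mapping.lookup (wt (height_monomial n c H)) CD = (c - of_int (H 0)) / 2"
  "uexp (height_monomial n c H) i l = (if i \<le> n \<and> l = H i then second_diff n H i else 0)"
proof -
  show "Poly_Mapping.lookup (wt (height_monomial n c H)) (CH i)
      = (if i \<le> n then of_int (second_diff n H i) else 0)"
    "Poly_Mapping.lookup (wt (height_monomial n c H)) CD = (c - of_int (H 0)) / 2"
    by (simp_all add: height_monomial_def wt_def lookup_add Poly_Mapping.lookup_sum lookup_single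
        when_def)
  have "uexp (height_monomial n c H) i l =
      (\<Sum>j\<in>{0..n}. if j = i then (if H i = l then second_diff n H i else 0) else 0)"
    unfolding uexp_def height_monomial_def snd_conv Poly_Mapping.lookup_sum lookup_single
    by (intro sum.cong) (auto simp: when_def)
  then show "uexp (height_monomial n c H) i l = (if i \<le> n \<and> l = H i then second_diff n H i else 0)"
    by auto
qed

lemma monomial_eqI:
  assumes "\<And>i. Poly_Mapping.lookup (wt m) (CH i) = Poly_Mapping.lookup (wt m') (CH i)"
    and "Poly_Mapping.lookup (wt m) CD = Poly_Mapping.lookup (wt m') CD"
    and "\<And>i l. uexp m i l = uexp m' i l"
  shows "m = m'"
proof (rule prod_eqI)
  show "fst m = fst m'"
  proof (rule poly_mapping_eqI)
    show "Poly_Mapping.lookup (fst m) c = Poly_Mapping.lookup (fst m') c" for c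
      using assms(1,2) by (cases c) (auto simp: wt_def)
  qed
  show "snd m = snd m'"
    using assms(3) by (intro poly_mapping_eqI) (auto simp: uexp_def)
qed

text \<open>Raising one height by \<open>2\<close> changes the values on the \<open>h_j\<close> as subtracting the simple root
  does.\<close>

lemma second_diff_step:
  assumes "n \<ge> 2" "i \<le> n" "j \<le> n"
  shows "second_diff n (H(i := H i + 2)) j = second_diff n H j - Cartan n j i"
proof -
  have "H' (nxt n j) + H' (prv n j) - 2 * H' j
      = H (nxt n j) + H (prv n j) - 2 * H j + (- Cartan n j i) * 2" if "H' = H(i := H i + 2)" for H'
    using neighbours_distinct[OF assms(1,3)] by (auto simp: that Cartan_def)
  then show ?thesis by (simp add: second_diff_def)
qed

lemma uexp_Avar:
  "uexp (m - Avar n i L) j l = uexp m j l - (if j = i \<and> l = L - 1 then 1 else 0) - (if j = i \<and> l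
      = L + 1 then 1 else 0)
     + (if j = prv n i \<and> l = L then 1 else 0) + (if j = nxt n i \<and> l = L then 1 else 0)"
  by (auto simp: uexp_def Avar_def expo_def Yvar_def lookup_add lookup_minus lookup_single when_def)

text \<open>The neighbours of a local minimum at height \<open>H i\<close> both have height \<open>H i + 1\<close>, which is the
  index of the variables \<open>Y_{i-1}\<close> and \<open>Y_{i+1}\<close> in \<open>A_{i,H i + 1}\<close>; so the new exponents sit at
  the right heights.\<close>

lemma height_monomial_step:
  assumes n: "n \<ge> 2" and i: "i \<le> n" and up: "H (nxt n i) = H i + 1" "H (prv n i) = H i + 1"
  shows "height_monomial n c H - Avar n i (H i + 1) = height_monomial n c (H(i := H i + 2))"
    (is "?m = height_monomial n c ?H")
proof (rule monomial_eqI)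
  note d = neighbours_distinct[OF n i]
  show "Poly_Mapping.lookup (wt ?m) (CH j) = Poly_Mapping.lookup (wt (height_monomial n c ?H)) (CH
      j)" for j
    using second_diff_step[OF n i, of j H]
    by (simp add: wt_simps lookup_minus lookup_height_monomial(1) lookup_sroot(1)[OF i] del:
        fun_upd_apply)
  show "Poly_Mapping.lookup (wt ?m) CD = Poly_Mapping.lookup (wt (height_monomial n c ?H)) CD"
    by (auto simp: wt_simps lookup_minus lookup_height_monomial(2) lookup_sroot(2)[OF i] field_simps)
  fix j l
  have sd: "second_diff n H i = 1" using up by (simp add: second_diff_def)
  consider "j = i" | "j = nxt n i" | "j = prv n i" | "j \<noteq> i" "j \<noteq> nxt n i" "j \<noteq> prv n i" by blast
  then show "uexp ?m j l = uexp (height_monomial n c ?H) j l"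
  proof cases
    case 1
    then show ?thesis using i d sd second_diff_step[OF n i i, of H]
      by (auto simp: uexp_Avar lookup_height_monomial(3) Cartan_def)
  next
    case 2
    have "second_diff n ?H j = second_diff n H j + 1"
      using second_diff_step[OF n i, of j H] d Cartan_sym[OF i, of j] by (simp add: Cartan_def 2)
    then show ?thesis using i d up 2
      by (auto simp: uexp_Avar lookup_height_monomial(3))
  next
    case 3
    have "second_diff n ?H j = second_diff n H j + 1"
      using second_diff_step[OF n i, of j H] d Cartan_sym[OF i, of j] by (simp add: Cartan_def 3)
    then show ?thesis using i d up 3
      by (auto simp: uexp_Avar lookup_height_monomial(3))
  next
    case 4
    have "second_diff n ?H j = second_diff n H j" if "j \<le> n"
      using second_diff_step[OF n i that, of H] 4 Cartan_sym[OF i that] by (simp add: Cartan_def)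
    then show ?thesis using 4
      by (auto simp: uexp_Avar lookup_height_monomial(3))
  qed
qed

lemma height_monomial_step':
  assumes n: "n \<ge> 2" and i: "i \<le> n" and "H (nxt n i) = H i - 1" "H (prv n i) = H i - 1"
  shows "height_monomial n c H + Avar n i (H i - 1) = height_monomial n c (H(i := H i - 2))"
  using height_monomial_step[OF n i, of "H(i := H i - 2)" c] assms(3,4) neighbours_distinct[OF n i]
  by (simp add: diff_eq_eq)

lemma unit_steps_flip:
  assumes n: "n \<ge> 2" and i: "i \<le> n" and H: "unit_steps n H"
    and "\<bar>h - H (nxt n i)\<bar> = 1" "\<bar>h - H (prv n i)\<bar> = 1"
  shows "unit_steps n (H(i := h))"
  unfolding unit_steps_def
proof (intro allI impI)
  fix j assume j: "j \<le> n"
  have "nxt n j = i \<longleftrightarrow> j = prv n i"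
    using nxt_eq_iff_prv[OF j i] by auto
  then show "\<bar>(H(i := h)) (nxt n j) - (H(i := h)) j\<bar> = 1"
    using assms j H neighbours_distinct[OF n i] unfolding unit_steps_def
    by (auto simp: abs_minus_commute)
qed

lemma height_monomial_cong:
  assumes "\<And>i. i \<le> n \<Longrightarrow> H i = H' i"
  shows "height_monomial n c H = height_monomial n c H'"
proof -
  have "nxt n i \<le> n" "prv n i \<le> n" for i
    by (simp_all add: nxt_def prv_def less_Suc_eq_le[symmetric])
  then have "second_diff n H i = second_diff n H' i" if "i \<le> n" for i
    using assms that by (simp add: second_diff_def)
  then show ?thesis using assms unfolding height_monomial_def
    by (auto intro!: arg_cong2[where f = "(+)"] sum.cong)
qed

text \<open>The second differences determine \<open>H\<close> up to a constant, which the value on \<open>d\<close> fixes.\<close>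

lemma inj_wt_height:
  assumes H: "unit_steps n H" and H': "unit_steps n H'"
    and eq: "wt (height_monomial n c H) = wt (height_monomial n c H')"
  shows "height_monomial n c H = height_monomial n c H'"
proof -
  define E where "E i = (of_int (H i - H' i) :: rat)" for i
  \<comment> \<open>Because of this the rounding in \<open>second_diff\<close> loses nothing.\<close>
  have ev: "even (H (nxt n i) + H (prv n i) - 2 * H i)" if "i \<le> n" "unit_steps n H" for i H
  proof -
    have "\<bar>H (nxt n i) - H i\<bar> = 1" "\<bar>H (prv n i) - H i\<bar> = 1"
      using that unit_steps_prv[OF that(2,1)] by (auto simp: unit_steps_def)
    then have "H (nxt n i) + H (prv n i) - 2 * H i \<in> {2, 0, - 2}" by auto
    moreover have "x \<in> {2, 0, - 2} \<Longrightarrow> even x" for x :: int by auto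
    ultimately show ?thesis by blast
  qed
  have "E (nxt n i) + E (prv n i) = 2 * E i" if i: "i \<le> n" for i
  proof -
    have "second_diff n H i = second_diff n H' i"
      using arg_cong[OF eq, of "\<lambda>\<mu>. Poly_Mapping.lookup \<mu> (CH i)"] i
      by (simp add: lookup_height_monomial)
    then have "H (nxt n i) + H (prv n i) - 2 * H i = H' (nxt n i) + H' (prv n i) - 2 * H' i"
      unfolding second_diff_def using ev[OF i H] ev[OF i H'] by (metis dvd_div_eq_cancel)
    then have "(H (nxt n i) - H' (nxt n i)) + (H (prv n i) - H' (prv n i)) = 2 * (H i - H' i)" by simp
    then show ?thesis unfolding E_def by (metis of_int_add of_int_mult of_int_numeral)
  qed
  moreover have "E 0 = 0"
    using arg_cong[OF eq, of "\<lambda>\<mu>. Poly_Mapping.lookup \<mu> CD"] by (simp add: lookup_height_monomial E_def)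
  ultimately have "E i = 0" if "i \<le> n" for i
    using periodic_harmonic_imp_constant[of n E] that by metis
  then show ?thesis
    by (intro height_monomial_cong) (simp add: E_def)
qed

lemma minuscule_heights:
  assumes n: "n \<ge> 2"
  shows "minuscule_crystal n (height_monomial n c ` {H. unit_steps n H})" (is "minuscule_crystal n ?X")
proof (rule minuscule_crystalI)
  show "inj_on wt ?X"
    using inj_wt_height by (force simp: inj_on_def)
next
  fix m assume "m \<in> ?X"
  then obtain H where m: "m = height_monomial n c H" and H: "unit_steps n H" by auto
  have "b \<in> insert CD (CH ` {0..n})" if "Poly_Mapping.lookup (wt m) b \<noteq> 0" for b
    using that by (cases b) (auto simp: m lookup_height_monomial split: if_splits)
  then show "wt m \<in> weight_lattice n"
    by (auto simp: weight_lattice_def in_keys_iff m lookup_height_monomial)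
  fix i assume i: "i \<le> n"
  have a: "\<bar>H (nxt n i) - H i\<bar> = 1" "\<bar>H (prv n i) - H i\<bar> = 1"
    using H unit_steps_prv[OF H i] i by (auto simp: unit_steps_def)
  consider "H (nxt n i) = H i + 1" "H (prv n i) = H i + 1" | "H (nxt n i) = H i - 1" "H (prv n i)
      = H i - 1"
    | "H (nxt n i) + H (prv n i) = 2 * H i"
    using a by linarith
  then show "pairing (wt m) (hvec i) = 0 \<and> (\<forall>l. uexp m i l = 0)
      \<or> pairing (wt m) (hvec i) = 1 \<and> (\<exists>L. (\<forall>l. uexp m i l = (if l = L then 1 else 0))
          \<and> m - Avar n i (L + 1) \<in> ?X)
      \<or> pairing (wt m) (hvec i) = - 1 \<and> (\<exists>L. (\<forall>l. uexp m i l = (if l = L then - 1 else 0))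
          \<and> m + Avar n i (L - 1) \<in> ?X)"
  proof cases
    case 1
    have "second_diff n H i = 1" using 1 by (simp add: second_diff_def)
    moreover have "unit_steps n (H(i := H i + 2))"
      using 1 by (intro unit_steps_flip[OF n i H]) auto
    ultimately show ?thesis using i height_monomial_step[OF n i 1]
      by (intro disjI2 disjI1 conjI exI[of _ "H i"]) (auto simp: m lookup_height_monomial)
  next
    case 2
    have "second_diff n H i = - 1" using 2 by (simp add: second_diff_def)
    moreover have "unit_steps n (H(i := H i - 2))"
      using 2 by (intro unit_steps_flip[OF n i H]) auto
    ultimately show ?thesis using i height_monomial_step'[OF n i 2]
      by (intro disjI2 conjI exI[of _ "H i"]) (auto simp: m lookup_height_monomial)
  next
    case 3
    then have "second_diff n H i = 0" by (simp add: second_diff_def)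
    then show ?thesis by (simp add: m lookup_height_monomial)
  qed
qed

text \<open>The distance to node \<open>r + 1\<close> on the cycle of length \<open>2 r + 2\<close> has its only local minimum, of
  height \<open>0\<close>, at \<open>r + 1\<close> and its only local maximum, of height \<open>r + 1\<close>, at \<open>0\<close>.\<close>

lemma fund_monomial_eq_height:
  assumes n: "n = 2 * r + 1" and "r \<ge> 1"
  defines "H \<equiv> \<lambda>i. \<bar>int i - int (r + 1)\<bar>"
  shows "unit_steps n H" "fund_monomial n (r + 1) = height_monomial n (of_nat (r + 1)) H"
proof -
  show "unit_steps n H"
    using n by (auto simp: unit_steps_def H_def nxt_eq)
  have sd: "second_diff n H i = (if i = r + 1 then 1 else if i = 0 then - 1 else 0)" if "i \<le> n" for i
  proof -
    have "H (nxt n i) + H (prv n i) - 2 * H i = 2 * (if i = r + 1 then 1 else if i = 0 then - 1 else 0)"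
      using n that assms(2) by (auto simp: H_def nxt_eq prv_eq abs_if)
    then show ?thesis by (simp add: second_diff_def)
  qed
  have rn: "r + 1 \<le> n" and dn: "dnum n (r + 1) = r + 1" using n by (simp_all add: dnum_def)
  show "fund_monomial n (r + 1) = height_monomial n (of_nat (r + 1)) H"
  proof (rule monomial_eqI)
    show "Poly_Mapping.lookup (wt (fund_monomial n (r + 1))) (CH i) =
        Poly_Mapping.lookup (wt (height_monomial n (of_nat (r + 1)) H)) (CH i)" for i
      unfolding lookup_height_monomial using rn by (auto simp: sd fund_monomial_def wt_def expo_def
          Yvar_def varpi_def Lam_def
        lookup_minus lookup_single when_def)
    show "Poly_Mapping.lookup (wt (fund_monomial n (r + 1))) CD =
        Poly_Mapping.lookup (wt (height_monomial n (of_nat (r + 1)) H)) CD"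
      unfolding lookup_height_monomial by (simp add: H_def fund_monomial_def wt_def expo_def
          Yvar_def varpi_def Lam_def
        lookup_minus lookup_single when_def)
    have "uexp (fund_monomial n (r + 1)) i l = (if i = r + 1 \<and> l = 0 then 1 else 0) - (if i = 0 \<and> l
        = int (r + 1) then 1 else 0)" for i l
      unfolding fund_monomial_def dn
      by (auto simp: uexp_def expo_def Yvar_def lookup_add lookup_minus lookup_single when_def)
    moreover have "H (r + 1) = 0" "H 0 = int (r + 1)" by (simp_all add: H_def)
    ultimately show "uexp (fund_monomial n (r + 1)) i l
        = uexp (height_monomial n (of_nat (r + 1)) H) i l" for i l
      unfolding lookup_height_monomial using rn by (auto simp: sd)
  qed
qed

theorem minuscule_fund_monomial:
  assumes "n = 2 * r + 1" "r \<ge> 1" "l \<in> {1, r + 1, n}"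
  shows "minuscule_crystal n (subcrystal n (fund_monomial n l))"
proof -
  have n: "n \<ge> 2" using assms by simp
  consider "l = 1" | "l = n" | "l = r + 1" using assms(3) by blast
  then show ?thesis
  proof cases
    case 1
    then show ?thesis using minuscule_subcrystal[OF minuscule_boxes[OF _ n, of 1]] n
      by (simp add: fund_monomial_eq_box del: One_nat_def)
  next
    case 2
    then show ?thesis using minuscule_subcrystal[OF minuscule_boxes[OF _ n, of "- 1"]] n
      by (simp add: fund_monomial_eq_box del: One_nat_def)
  next
    case 3
    then show ?thesis using fund_monomial_eq_height[OF assms(1,2)]
      by (auto intro!: minuscule_subcrystal[OF minuscule_heights[OF n]])
  qed
qed

section \<open>The toroidal algebra as a quotient of a free algebra\<close>

lemma con_in_carrier: "con c \<in> carrier (free_algebra G)"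
  by (auto simp: free_algebra_def con_def zero_fword_def)

lemma gen_in_carrier: "g \<in> G \<Longrightarrow> gen g \<in> carrier (free_algebra G)"
  by (simp add: free_algebra_def gen_def)

lemma con_simps: "con 0 = 0" "con 1 = 1"
  by (simp_all add: con_def)

lemma free_algebra_closed:
  assumes "a \<in> carrier (free_algebra G)" "b \<in> carrier (free_algebra G)"
  shows "a + b \<in> carrier (free_algebra G)" "a * b \<in> carrier (free_algebra G)"
    "a - b \<in> carrier (free_algebra G)"
proof -
  interpret ring "free_algebra G" by (rule ring_free_algebra)
  show "a + b \<in> carrier (free_algebra G)" "a * b \<in> carrier (free_algebra G)"
    using add.m_closed[OF assms] m_closed[OF assms] by (simp_all add: free_algebra_def)
  show "a - b \<in> carrier (free_algebra G)"
    using assms Poly_Mapping.keys_add[of a "- b"] by (auto simp: free_algebra_def)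
qed

lemma sum_in_set:
  assumes "0 \<in> S" "\<And>a b. a \<in> S \<Longrightarrow> b \<in> S \<Longrightarrow> a + b \<in> S" "\<And>i. i \<in> I \<Longrightarrow> f i \<in> S"
  shows "sum f I \<in> (S :: 'a::comm_monoid_add set)"
  using assms(3)
  by (induction I rule: infinite_finite_induct) (auto intro: assms(1,2))

context
  fixes S :: "'g falg set"
  assumes con: "\<And>c. con c \<in> S"
    and add: "\<And>a b. a \<in> S \<Longrightarrow> b \<in> S \<Longrightarrow> a + b \<in> S"
    and mult: "\<And>a b. a \<in> S \<Longrightarrow> b \<in> S \<Longrightarrow> a * b \<in> S"
begin

lemma fps_power_nth_in_set:
  assumes "\<And>a. a \<le> k \<Longrightarrow> fps_nth F a \<in> S" "a \<le> k"
  shows "fps_nth (F ^ j) a \<in> S"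
  using assms(2)
proof (induction j arbitrary: a)
  case 0
  then show ?case using con[of 0] con[of 1] by (simp add: con_simps)
next
  case (Suc j)
  then show ?case using con[of 0] assms(1)
    by (auto simp: fps_mult_nth con_simps intro!: sum_in_set add mult)
qed

lemma exp_coeff_in_set:
  assumes "\<And>a. a \<le> k \<Longrightarrow> fps_nth F a \<in> S"
  shows "exp_coeff F k \<in> S"
  unfolding exp_coeff_def
  using con[of 0] by (auto simp: con_simps intro!: sum_in_set add mult con fps_power_nth_in_set[OF
      assms])

text \<open>Up to \<open>F_k\<close> itself, the \<open>k\<close>-th coefficient of \<open>exp F\<close> is a polynomial in the lower
  coefficients of \<open>F\<close>. This allows one to recover the \<open>h_{i,m}\<close> inductively from the coefficients
  of \<open>\<phi>_i(z)\<close>.\<close>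

lemma exp_coeff_leading:
  assumes F0: "fps_nth F 0 = 0" and k: "k \<ge> 1" and F: "\<And>a. a < k \<Longrightarrow> fps_nth F a \<in> S"
  obtains c where "c \<in> S" "exp_coeff F k = fps_nth F k + c"
proof -
  have pw0: "fps_nth (F ^ Suc j) 0 = 0" for j
    by (simp add: fps_mult_nth F0)
  have high: "fps_nth (F ^ Suc (Suc j)) k \<in> S" for j
  proof -
    have "fps_nth F i * fps_nth (F ^ Suc j) (k - i) \<in> S" if "i \<in> {0..k}" for i
    proof (cases "i = 0 \<or> i = k")
      case True
      then show ?thesis using F0 pw0[of j] con[of 0] by (auto simp: con_simps)
    next
      case False
      then show ?thesis using that
        by (intro mult F fps_power_nth_in_set[of "k - i"]) auto
    qed
    then have "(\<Sum>i=0..k. fps_nth F i * fps_nth (F ^ Suc j) (k - i)) \<in> S"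
      using con[of 0] by (intro sum_in_set add) (auto simp: con_simps)
    then show ?thesis by (simp only: power_Suc[of F "Suc j"] fps_mult_nth)
  qed
  have split: "{..k} = insert 0 (insert 1 {2..k})" using k by auto
  have "exp_coeff F k = fps_nth F k + (\<Sum>j\<in>{2..k}. con (1 / fact j) * fps_nth (F ^ j) k)"
    unfolding exp_coeff_def split using k by (simp add: con_simps)
  moreover have "con (1 / fact j) * fps_nth (F ^ j) k \<in> S" if "j \<in> {2..k}" for j
  proof -
    obtain j' where "j = Suc (Suc j')" using \<open>j \<in> {2..k}\<close>
      by (metis add_2_eq_Suc atLeastAtMost_iff le_Suc_ex)
    then show ?thesis using con high mult by blast
  qed
  then have "(\<Sum>j\<in>{2..k}. con (1 / fact j) * fps_nth (F ^ j) k) \<in> S"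
    using con[of 0] by (intro sum_in_set add) (auto simp: con_simps)
  ultimately show ?thesis using that by blast
qed

end

lemma hvec_in_cartan: "i \<le> n \<Longrightarrow> hvec i \<in> cartan_space n" "i \<le> n \<Longrightarrow> - hvec i \<in> cartan_space n"
  by (auto simp: cartan_space_def hvec_def)

lemma sg_cases: "sg s = (1::'a::{one,uminus}) \<or> sg s = (- 1 :: 'a)"
  by (cases s) auto

lemma generators_in_carrier:
  "i \<le> n \<Longrightarrow> xx s i a \<in> carrier (free_algebra (qtor_gens n))"
  "h \<in> cartan_space n \<Longrightarrow> kk h \<in> carrier (free_algebra (qtor_gens n))"
  "i \<le> n \<Longrightarrow> m \<noteq> 0 \<Longrightarrow> hh i m \<in> carrier (free_algebra (qtor_gens n))"
  by (auto intro!: gen_in_carrier simp: qtor_gens_def)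

lemma zero_one_in_carrier: "0 \<in> carrier (free_algebra G)" "1 \<in> carrier (free_algebra G)"
  using con_in_carrier[of 0] con_in_carrier[of 1] by (simp_all add: con_simps)

lemma phi_in_carrier:
  assumes "i \<le> n"
  shows "phi t s i a \<in> carrier (free_algebra (qtor_gens n))"
proof -
  have "exp_coeff (Abs_fps (\<lambda>a. if a = 0 then 0
              else con (sg s * (qpow t 1 - qpow t (- 1))) * hh i (sg s * int a))) k
       \<in> carrier (free_algebra (qtor_gens n))" for k
    using assms sg_cases[of s, where ?'a = int]
    by (intro exp_coeff_in_set free_algebra_closed con_in_carrier)
      (auto intro!: free_algebra_closed con_in_carrier generators_in_carrier zero_one_in_carrier)
  then show ?thesis
    using assms unfolding phi_def
    by (auto intro!: free_algebra_closed generators_in_carrier zero_one_in_carrier hvec_in_cartan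
        split: pm.split)
qed

text \<open>The ideal generated by a set is the intersection of the ideals that contain it, which is an
  ideal as soon as the whole ring is among these.\<close>

lemma qtor_rels_carrier: "qtor_rels n t \<subseteq> carrier (free_algebra (qtor_gens n))"
proof
  fix a assume "a \<in> qtor_rels n t"
  then show "a \<in> carrier (free_algebra (qtor_gens n))"
  proof cases
    case (k_add h h')
    then have "h + h' \<in> cartan_space n"
      using Poly_Mapping.keys_add[of h h'] by (auto simp: cartan_space_def)
    then show ?thesis using k_add by (auto intro!: free_algebra_closed generators_in_carrier)
  next
    case k_zero
    then show ?thesis
      by (auto intro!: free_algebra_closed generators_in_carrier zero_one_in_carrier simp:
          cartan_space_def)
  next
    case (k_x h j s a)
    then have "- h \<in> cartan_space n" by (simp add: cartan_space_def)
    then show ?thesis using k_x by (auto intro!: free_algebra_closed generators_in_carrier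
        con_in_carrier)
  next
    case (serre i j s a b c)
    then have "j \<le> n"
      by (auto simp: nxt_def prv_def less_Suc_eq_le[symmetric])
    then show ?thesis using serre
      by (auto simp: serre_def intro!: free_algebra_closed generators_in_carrier con_in_carrier)
  qed (auto simp: commut_def intro!: free_algebra_closed generators_in_carrier con_in_carrier
      phi_in_carrier zero_one_in_carrier)
qed

lemma ideal_qtor_ideal: "ideal (qtor_ideal n t) (free_algebra (qtor_gens n))"
  unfolding qtor_ideal_def
  by (rule ring.genideal_ideal[OF ring_free_algebra qtor_rels_carrier])

lemma cls_hom: "cls n t \<in> ring_hom (free_algebra (qtor_gens n)) (qtor n t)"
  using ideal.rcos_ring_hom[OF ideal_qtor_ideal, of n t]
  by (simp add: cls_def[abs_def] qtor_def)

lemma cls_simps: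
  assumes "a \<in> carrier (free_algebra (qtor_gens n))" "b \<in> carrier (free_algebra (qtor_gens n))"
  shows "cls n t (a + b) = cls n t a \<oplus>\<^bsub>qtor n t\<^esub> cls n t b"
    "cls n t (a * b) = cls n t a \<otimes>\<^bsub>qtor n t\<^esub> cls n t b"
  using ring_hom_add[OF cls_hom assms] ring_hom_mult[OF cls_hom assms]
  by (simp_all add: free_algebra_def)

lemma cls_one: "cls n t (con 1) = \<one>\<^bsub>qtor n t\<^esub>"
  using ring_hom_one[OF cls_hom] by (simp add: free_algebra_def con_simps)

lemma cls_closed: "a \<in> carrier (free_algebra (qtor_gens n)) \<Longrightarrow> cls n t a \<in> carrier (qtor n t)"
  by (rule ring_hom_closed[OF cls_hom])

lemma ring_qtor: "ring (qtor n t)"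
  unfolding qtor_def by (rule ideal.quotient_is_ring[OF ideal_qtor_ideal])

lemma cls_rel:
  assumes "a \<in> qtor_rels n t"
  shows "cls n t a = cls n t (con 0)"
proof -
  interpret ideal "qtor_ideal n t" "free_algebra (qtor_gens n)" by (rule ideal_qtor_ideal)
  have "a \<in> qtor_ideal n t"
    using assms ring.genideal_self[OF ring_free_algebra qtor_rels_carrier] unfolding qtor_ideal_def
        by blast
  moreover have "con 0 \<in> qtor_ideal n t"
    using zero_closed additive_subgroup.zero_closed[OF is_additive_subgroup]
    by (simp add: con_simps free_algebra_def)
  ultimately show ?thesis unfolding cls_def
    using a_rcos_const by metis
qed

section \<open>Powers of a generic parameter\<close>

text \<open>A rational power of \<open>q\<close> that equals \<open>1\<close> yields an integral one by clearing the denominator.\<close>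

lemma qpow_eq_1_iff:
  assumes "\<forall>k::nat. k > 0 \<longrightarrow> exp t ^ k \<noteq> 1"
  shows "qpow t x = 1 \<longleftrightarrow> x = 0"
proof
  assume 1: "qpow t x = 1"
  show "x = 0"
  proof (rule ccontr)
    assume "x \<noteq> 0"
    obtain p q where pq: "x = of_int p / of_int q" "q > 0"
      by (metis quotient_of_denom_pos' quotient_of_div surjective_pairing)
    have "t * of_rat x * of_nat (nat q) = t * of_int p"
      using pq by (simp add: of_rat_divide)
    then have "exp (t * of_int p) = qpow t x ^ nat q"
      unfolding qpow_def by (metis exp_of_nat_mult mult.commute)
    then have p1: "exp (t * of_int p) = 1" using 1 by simp
    have "exp (t * of_nat (nat \<bar>p\<bar>)) = 1"
      using p1 by (cases "p \<ge> 0") (auto simp: exp_minus)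
    then have "exp t ^ nat \<bar>p\<bar> = 1"
      by (metis exp_of_nat_mult mult.commute)
    moreover have "nat \<bar>p\<bar> > 0" using pq \<open>x \<noteq> 0\<close> by auto
    ultimately show False using assms by blast
  qed
qed (simp add: qpow_def)

lemma qpow_add: "qpow t (x + y) = qpow t x * qpow t y"
  by (simp add: qpow_def of_rat_add distrib_left exp_add)

lemma qpow_eq_iff:
  assumes "\<forall>k::nat. k > 0 \<longrightarrow> exp t ^ k \<noteq> 1"
  shows "qpow t x = qpow t y \<longleftrightarrow> x = y"
proof -
  have "qpow t x = qpow t (x - y) * qpow t y" using qpow_add[of t "x - y" y] by simp
  then have "qpow t x = qpow t y \<longleftrightarrow> qpow t (x - y) = 1" by (simp add: qpow_def)
  then show ?thesis by (simp add: qpow_eq_1_iff[OF assms])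
qed

lemma qint_eq_0_iff:
  assumes "\<forall>k::nat. k > 0 \<longrightarrow> exp t ^ k \<noteq> 1"
  shows "qint t k = 0 \<longleftrightarrow> k = 0"
proof -
  have "(of_int k :: rat) = - of_int k \<longleftrightarrow> k = 0" by linarith
  then show ?thesis by (simp add: qint_def qpow_eq_iff[OF assms])
qed

lemma qint_1:
  assumes "\<forall>k::nat. k > 0 \<longrightarrow> exp t ^ k \<noteq> 1"
  shows "qint t 1 = 1"
  using qint_eq_0_iff[OF assms, of 1] by (auto simp: qint_def split: if_splits)

section \<open>Modules over the toroidal algebra\<close>

lemma subalgebra_closed:
  assumes "S \<subseteq> carrier (qtor n t)" "a \<in> subalgebra n t S"
  shows "a \<in> carrier (qtor n t)"
proof -
  interpret ring "qtor n t" by (rule ring_qtor)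
  show ?thesis using assms(2)
    by induction (use assms(1) cls_closed[OF con_in_carrier] in auto)
qed

lemma cartan_spaceI: "Poly_Mapping.keys h \<subseteq> CH ` ({0..n} - {j}) \<Longrightarrow> h \<in> cartan_space n"
  unfolding cartan_space_def by blast

lemma vertical_gens_closed:
  "{cls n t (xx s i a) | s i a. i \<in> {0..n} - {j}}
      \<union> {cls n t (hh i m) | i m. i \<in> {0..n} - {j} \<and> m \<noteq> 0}
      \<union> {cls n t (kk h) | h. Poly_Mapping.keys h \<subseteq> CH ` ({0..n} - {j})} \<subseteq> carrier (qtor n t)"
  by (auto intro!: cls_closed generators_in_carrier intro: cartan_spaceI)

locale toroidal_module = vector_space scale
  for scale :: "complex \<Rightarrow> 'v \<Rightarrow> 'v::ab_group_add" +
  fixes n :: nat and t :: complex and act :: "qtor_elem \<Rightarrow> 'v \<Rightarrow> 'v"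
  assumes qtor_module: "qtor_module n t scale act"
begin

abbreviation rho :: "qgen falg \<Rightarrow> 'v \<Rightarrow> 'v" where
  "rho a \<equiv> act (cls n t a)"

abbreviation free_elems :: "qgen falg set" where
  "free_elems \<equiv> carrier (free_algebra (qtor_gens n))"

lemma act_linear:
  assumes "A \<in> carrier (qtor n t)"
  shows "act A (u + v) = act A u + act A v" "act A (scale c v) = scale c (act A v)"
    "act A 0 = 0"
proof -
  have lin: "Vector_Spaces.linear scale scale (act A)"
    using qtor_module assms by (auto simp: qtor_module_def)
  then have add: "act A (u + v) = act A u + act A v" and sc: "act A (scale c v)
      = scale c (act A v)" for u v c
    by (auto simp: Vector_Spaces.linear_iff)
  show "act A (u + v) = act A u + act A v" "act A (scale c v) = scale c (act A v)"
      by (rule add, rule sc)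
  show "act A 0 = 0" using sc[of 0 0] by simp
qed

lemma act_algebra:
  assumes "A \<in> carrier (qtor n t)" "B \<in> carrier (qtor n t)"
  shows "act (A \<oplus>\<^bsub>qtor n t\<^esub> B) v = act A v + act B v" "act (A \<otimes>\<^bsub>qtor n t\<^esub> B) v = act A (act B v)"
  using qtor_module assms by (auto simp: qtor_module_def)

lemma rho_con: "rho (con c) v = scale c v"
  using qtor_module by (auto simp: qtor_module_def)

lemma rho_algebra:
  assumes "a \<in> free_elems" "b \<in> free_elems"
  shows "rho (a + b) v = rho a v + rho b v" "rho (a * b) v = rho a (rho b v)" "rho (a - b) v
      = rho a v - rho b v"
proof -
  have add: "rho (a + b) v = rho a v + rho b v" if "a \<in> free_elems" "b \<in> free_elems" for a b
    using that by (simp add: cls_simps cls_closed act_algebra)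
  show "rho (a + b) v = rho a v + rho b v" by (rule add[OF assms])
  show "rho (a * b) v = rho a (rho b v)"
    using assms by (simp add: cls_simps cls_closed act_algebra)
  show "rho (a - b) v = rho a v - rho b v"
    using add[of "a - b" b] assms free_algebra_closed[OF assms] by (simp add: algebra_simps)
qed

lemma rho_rel: "a \<in> qtor_rels n t \<Longrightarrow> rho a v = 0"
  using cls_rel[of a n t] rho_con[of 0 v] by simp

lemma kk_inverse:
  assumes "h \<in> cartan_space n"
  shows "rho (kk (- h)) (rho (kk h) v) = v"
proof -
  have h: "- h \<in> cartan_space n" "0 \<in> cartan_space n" using assms by (auto simp: cartan_space_def)
  have "rho (kk (- h) * kk h - kk (- h + h)) v = 0"
    by (rule rho_rel[OF qtor_rels.k_add[OF h(1) assms]])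
  moreover have "rho (kk 0 - 1) v = 0" by (rule rho_rel[OF qtor_rels.k_zero])
  moreover have "rho 1 v = v" using rho_con[of 1 v] by (simp add: con_simps)
  ultimately show ?thesis
    using assms h by (simp add: rho_algebra generators_in_carrier free_algebra_closed
        zero_one_in_carrier)
qed

lemma act_span:
  assumes A: "A \<in> carrier (qtor n t)" and B: "\<And>x. x \<in> B \<Longrightarrow> act A x \<in> span B'" and v: "v \<in> span B"
  shows "act A v \<in> span B'"
  using v
proof (induction rule: span_induct)
  case base
  show ?case by (rule subspaceI) (auto simp: act_linear[OF A] intro: span_zero span_add span_scale)
qed (rule B)

text \<open>Scalars belong to \<open>S\<close>, so that a subalgebra sweeps out a vector space.\<close>

lemma subspace_orbit:
  assumes "S \<subseteq> carrier (qtor n t)"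
    and con: "\<And>c. cls n t (con c) \<in> S"
    and add: "\<And>a b. a \<in> S \<Longrightarrow> b \<in> S \<Longrightarrow> a \<oplus>\<^bsub>qtor n t\<^esub> b \<in> S"
    and mult: "\<And>a b. a \<in> S \<Longrightarrow> b \<in> S \<Longrightarrow> a \<otimes>\<^bsub>qtor n t\<^esub> b \<in> S"
  shows "subspace {act a v | a. a \<in> S}"
proof (rule subspaceI)
  show "0 \<in> {act a v | a. a \<in> S}"
    using con[of 0] rho_con[of 0 v] by force
next
  fix x y assume "x \<in> {act a v | a. a \<in> S}" "y \<in> {act a v | a. a \<in> S}"
  then obtain a b where ab: "a \<in> S" "b \<in> S" "x = act a v" "y = act b v" by blast
  then have "x + y = act (a \<oplus>\<^bsub>qtor n t\<^esub> b) v" using act_algebra assms(1) by (simp add: subset_iff)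
  then show "x + y \<in> {act a v | a. a \<in> S}" using add ab by blast
next
  fix c x assume "x \<in> {act a v | a. a \<in> S}"
  then obtain a where a: "a \<in> S" "x = act a v" by blast
  then have "scale c x = act (cls n t (con c) \<otimes>\<^bsub>qtor n t\<^esub> a) v"
    using act_algebra(2)[of "cls n t (con c)" a v] assms(1) con[of c] by (simp add: subset_iff rho_con)
  then show "scale c x \<in> {act a v | a. a \<in> S}" using mult con a by blast
qed

lemma subspace_subalgebra_orbit:
  assumes "S \<subseteq> carrier (qtor n t)"
  shows "subspace {act a v | a. a \<in> subalgebra n t S}"
proof (rule subspace_orbit)
  show "subalgebra n t S \<subseteq> carrier (qtor n t)" using subalgebra_closed[OF assms] by blast
qed (rule subalgebra.scalar subalgebra.add subalgebra.mult; assumption)+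

lemma subspace_weight_space: "subspace (weight_space n t scale act \<nu>)"
  unfolding weight_space_def
  by (rule subspaceI)
    (auto simp: act_linear[OF cls_closed[OF generators_in_carrier(2)]] scale_right_distrib
        scale_left_commute)

text \<open>The relation for \<open>[h_{i,m}, x_{i,0}]\<close> expresses \<open>x_{i,m}\<close> through \<open>h_{i,m}\<close> and \<open>x_{i,0}\<close>,
  its coefficient \<open>[2m]_q / m\<close> being non-zero.\<close>

lemma xx_span_invariant:
  assumes root: "\<forall>k::nat. k > 0 \<longrightarrow> exp t ^ k \<noteq> 1" and i: "i \<le> n"
    and x: "\<And>v. v \<in> span B \<Longrightarrow> rho (xx s i 0) v \<in> span B"
    and h: "\<And>m v. m \<noteq> 0 \<Longrightarrow> v \<in> span B \<Longrightarrow> rho (hh i m) v \<in> span B"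
    and v: "v \<in> span B"
  shows "rho (xx s i m) v \<in> span B"
proof (cases "m = 0")
  case False
  define \<kappa> where "\<kappa> = (sg s * (1 / of_int m) * qint t (m * Cartan n i i) :: complex)"
  have "\<kappa> \<noteq> 0"
    using False by (cases s) (simp_all add: \<kappa>_def Cartan_def qint_eq_0_iff[OF root])
  have "rho (commut (hh i m) (xx s i 0) - con \<kappa> * xx s i (m + 0)) v = 0"
    unfolding \<kappa>_def using i False by (intro rho_rel qtor_rels.h_x) auto
  then have eq: "rho (hh i m) (rho (xx s i 0) v) - rho (xx s i 0) (rho (hh i m) v)
      = scale \<kappa> (rho (xx s i m) v)"
    using i False
    by (simp add: commut_def rho_algebra rho_con generators_in_carrier free_algebra_closed
        con_in_carrier)
  have "scale \<kappa> (rho (xx s i m) v) \<in> span B"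
    unfolding eq[symmetric] using x h v False by (intro span_diff) auto
  then have "scale (1 / \<kappa>) (scale \<kappa> (rho (xx s i m) v)) \<in> span B" by (rule span_scale)
  then show ?thesis using \<open>\<kappa> \<noteq> 0\<close> by simp
qed (use x v in auto)

end

section \<open>Modules with a minuscule basis\<close>

locale minuscule_module = toroidal_module scale n t act
  for scale :: "complex \<Rightarrow> 'v \<Rightarrow> 'v::ab_group_add" and n t act +
  fixes m0 :: monomial and b :: "monomial \<Rightarrow> 'v"
  assumes generic: "\<forall>k::nat. k > 0 \<longrightarrow> exp t ^ k \<noteq> 1"
    and n: "n \<ge> 2"
    and monomial_module: "monomial_module n t scale act m0 b"
    and minuscule: "minuscule_crystal n (subcrystal n m0)"
begin

abbreviation crystal :: "monomial set" where
  "crystal \<equiv> subcrystal n m0"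

lemma basis:
  "inj_on b crystal" "independent (b ` crystal)" "span (b ` crystal) = UNIV"
  using monomial_module by (auto simp: monomial_module_def)

lemma basis_action:
  assumes "m \<in> crystal"
  shows "h \<in> cartan_space n \<Longrightarrow> rho (kk h) (b m) = scale (qpow t (pairing (wt m) h)) (b m)"
    and "i \<le> n \<Longrightarrow> rho (phi t s i (sg s * int a)) (b m)
        = scale (fps_nth (lweight_series t s i m) a) (b m)"
    and "i \<le> n \<Longrightarrow> rho (xx Pl i 0) (b m) = ovec b (etil n i m)"
    and "i \<le> n \<Longrightarrow> rho (xx Mi i 0) (b m) = ovec b (ftil n i m)"
  using monomial_module assms by (auto simp: monomial_module_def)

lemma wt_in_lattice: "m \<in> crystal \<Longrightarrow> wt m \<in> weight_lattice n"
  using minuscule by (auto simp: minuscule_crystal_def)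

lemma wt_inj: "m \<in> crystal \<Longrightarrow> m' \<in> crystal \<Longrightarrow> wt m = wt m' \<Longrightarrow> m = m'"
  using minuscule by (auto simp: minuscule_crystal_def dest: inj_onD)

lemma string_cases:
  assumes "m \<in> crystal" "i \<le> n"
  obtains
    "pairing (wt m) (hvec i) = 0" "rho (xx Pl i 0) (b m) = 0" "rho (xx Mi i 0) (b m) = 0"
  | m' where "m' \<in> crystal" "pairing (wt m) (hvec i) = 1" "rho (xx Pl i 0) (b m) = 0"
      "rho (xx Mi i 0) (b m) = b m'" "wt m' = wt m - sroot n i"
  | m' where "m' \<in> crystal" "pairing (wt m) (hvec i) = - 1" "rho (xx Pl i 0) (b m) = b m'"
      "rho (xx Mi i 0) (b m) = 0" "wt m' = wt m + sroot n i"
proof -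
  note act = basis_action(3,4)[OF assms]
  have "pairing (wt m) (hvec i) = 0 \<and> etil n i m = None \<and> ftil n i m = None
      \<or> pairing (wt m) (hvec i) = 1 \<and> etil n i m = None \<and>
          (\<exists>m'\<in>crystal. ftil n i m = Some m' \<and> wt m' = wt m - sroot n i)
      \<or> pairing (wt m) (hvec i) = - 1 \<and> ftil n i m = None \<and>
          (\<exists>m'\<in>crystal. etil n i m = Some m' \<and> wt m' = wt m + sroot n i)"
    using minuscule assms unfolding minuscule_crystal_def by auto
  then show thesis
  proof (elim disjE conjE bexE)
    assume "pairing (wt m) (hvec i) = 0" "etil n i m = None" "ftil n i m = None"
    then show thesis using act by (intro that(1)) (simp_all add: ovec_def)
  next
    fix m' assume "pairing (wt m) (hvec i) = 1" "etil n i m = None" "m' \<in> crystal"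
      "ftil n i m = Some m'" "wt m' = wt m - sroot n i"
    then show thesis using act by (intro that(2)[of m']) (simp_all add: ovec_def)
  next
    fix m' assume "pairing (wt m) (hvec i) = - 1" "ftil n i m = None" "m' \<in> crystal"
      "etil n i m = Some m'" "wt m' = wt m + sroot n i"
    then show thesis using act by (intro that(3)[of m']) (simp_all add: ovec_def)
  qed
qed

lemma sroot_pairing_self: "i \<le> n \<Longrightarrow> Poly_Mapping.lookup (sroot n i) (CH i) = 2"
  by (simp add: lookup_sroot Cartan_def)

text \<open>An arrow of colour \<open>i\<close> changes the weight by \<open>\<plusminus> \<alpha>_i\<close> and thus ends where the value on \<open>h_i\<close>
  has the opposite sign; there the same operator vanishes.\<close>

lemma xx_square_zero:
  assumes "i \<le> n"
  shows "rho (xx s i 0) (rho (xx s i 0) v) = 0"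
proof -
  have X: "cls n t (xx s i 0) \<in> carrier (qtor n t)" for s
    by (intro cls_closed generators_in_carrier assms)
  have basis0: "rho (xx s i 0) (rho (xx s i 0) (b m)) = 0" if m: "m \<in> crystal" for m
    using m assms
  proof (cases rule: string_cases)
    case 1
    then show ?thesis by (cases s) (simp_all add: act_linear[OF X])
  next
    case (2 m')
    have "pairing (wt m') (hvec i) = - 1" using 2 assms by (simp add: lookup_minus sroot_pairing_self)
    then have "rho (xx Mi i 0) (b m') = 0"
      using string_cases[OF 2(1) assms] by fastforce
    then show ?thesis using 2 by (cases s) (simp_all add: act_linear[OF X])
  next
    case (3 m')
    have "pairing (wt m') (hvec i) = 1" using 3 assms by (simp add: lookup_add sroot_pairing_self)
    then have "rho (xx Pl i 0) (b m') = 0"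
      using string_cases[OF 3(1) assms] by fastforce
    then show ?thesis using 3 by (cases s) (simp_all add: act_linear[OF X])
  qed
  have "v \<in> span (b ` crystal)" using basis by simp
  then show ?thesis
  proof (induction rule: span_induct)
    case base
    show ?case by (rule subspaceI) (auto simp: act_linear[OF X])
  qed (use basis0 in auto)
qed

lemma xx_basis:
  assumes "m \<in> crystal" "i \<le> n"
  shows "rho (xx s i 0) (b m) = 0 \<or> (\<exists>m'\<in>crystal. rho (xx s i 0) (b m) = b m' \<and>
    (wt m' = wt m + sroot n i \<or> wt m' = wt m - sroot n i))"
  using assms by (cases rule: string_cases) (cases s; auto)+

section \<open>Weight spaces\<close>

text \<open>Coordinates with respect to the basis \<open>(v_m)\<close>, indexed by monomials.\<close>

definition coef :: "'v \<Rightarrow> monomial \<Rightarrow> complex" where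
  "coef v m = representation (b ` crystal) v (b m)"

lemma in_span [simp]: "v \<in> span (b ` crystal)"
  using basis by simp

lemma coef_linear:
  "coef (u + v) m = coef u m + coef v m" "coef (scale c v) m = c * coef v m" "coef 0 m = 0"
  "coef (sum f A) m = (\<Sum>x\<in>A. coef (f x) m)" "coef (u - v) m = coef u m - coef v m"
  unfolding coef_def using basis
  by (simp_all add: representation_add representation_scale representation_zero representation_sum
      representation_diff)

lemma coef_basis: "m \<in> crystal \<Longrightarrow> m' \<in> crystal \<Longrightarrow> coef (b m) m' = (if m' = m then 1 else 0)"
  using basis(1) unfolding coef_def representation_basis[OF basis(2) imageI]
  by (auto dest: inj_onD)

abbreviation supp :: "'v \<Rightarrow> monomial set" where
  "supp v \<equiv> {m \<in> crystal. coef v m \<noteq> 0}"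

lemma supp_image: "{x. representation (b ` crystal) v x \<noteq> 0} = b ` supp v"
  using representation_ne_zero[of "b ` crystal" v] unfolding coef_def by auto

lemma finite_supp: "finite (supp v)"
proof -
  have "finite (b ` supp v)"
    using finite_representation[of "b ` crystal" v] by (simp add: supp_image)
  then show ?thesis
    by (rule finite_imageD) (rule inj_on_subset[OF basis(1)], auto)
qed

lemma expansion: "(\<Sum>m\<in>supp v. scale (coef v m) (b m)) = v"
proof -
  have "v = (\<Sum>x\<in>b ` supp v. scale (representation (b ` crystal) v x) x)"
    using sum_nonzero_representation_eq[OF basis(2) in_span, of v] by (simp add: supp_image)
  also have "\<dots> = (\<Sum>m\<in>supp v. scale (coef v m) (b m))"
    unfolding coef_def
    by (subst sum.reindex) (auto intro: inj_on_subset[OF basis(1)])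
  finally show ?thesis by simp
qed

lemma coef_eqI:
  assumes "\<And>m. m \<in> crystal \<Longrightarrow> coef u m = coef v m"
  shows "u = v"
proof -
  have empty: "supp (u - v) = {}" using assms by (auto simp: coef_linear)
  have "u - v = 0" using expansion[of "u - v"] unfolding empty by simp
  then show ?thesis by simp
qed

lemma coef_kk:
  assumes h: "h \<in> cartan_space n" and m: "m \<in> crystal"
  shows "coef (rho (kk h) v) m = qpow t (pairing (wt m) h) * coef v m"
  using in_span[of v]
proof (induction rule: span_induct)
  case base
  have "cls n t (kk h) \<in> carrier (qtor n t)" by (intro cls_closed generators_in_carrier h)
  note lin = act_linear[OF this]
  show ?case by (rule subspaceI) (auto simp: lin coef_linear algebra_simps)
next
  case (step x)
  then show ?case using h m by (auto simp: basis_action coef_linear coef_basis)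
qed

text \<open>The \<open>h_i\<close> and \<open>d\<close> act on weight vectors by powers of \<open>q\<close>, and a power of \<open>q\<close> determines its
  exponent, so different weights give different eigenvalues.\<close>

lemma weight_space_coef:
  assumes v: "v \<in> weight_space n t scale act \<nu>" and \<nu>: "\<nu> \<in> weight_lattice n"
    and m: "m \<in> crystal" and "coef v m \<noteq> 0"
  shows "wt m = \<nu>"
proof -
  have "pairing (wt m) h = pairing \<nu> h" if h: "h \<in> cartan_space n" for h
  proof -
    have "rho (kk h) v = scale (qpow t (pairing \<nu> h)) v"
      using v h by (simp add: weight_space_def)
    then have "qpow t (pairing \<nu> h) * coef v m = qpow t (pairing (wt m) h) * coef v m"
      using coef_kk[OF h m, of v] by (simp add: coef_linear)
    then show ?thesis using assms(4) by (simp add: qpow_eq_iff[OF generic])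
  qed
  note eq = this
  have keys: "Poly_Mapping.keys (wt m) \<subseteq> insert CD (CH ` {0..n})" "Poly_Mapping.keys \<nu>
      \<subseteq> insert CD (CH ` {0..n})"
    using wt_in_lattice[OF m] \<nu> by (auto simp: weight_lattice_def)
  show ?thesis
  proof (rule poly_mapping_eqI)
    fix c
    show "Poly_Mapping.lookup (wt m) c = Poly_Mapping.lookup \<nu> c"
    proof (cases "c \<in> insert CD (CH ` {0..n})")
      case True
      then have "Poly_Mapping.single c 1 \<in> cartan_space n" by (simp add: cartan_space_def)
      from eq[OF this] show ?thesis by (simp add: pairing_def)
    next
      case False
      then show ?thesis using keys by (metis in_mono in_keys_iff)
    qed
  qed
qed

text \<open>Existence collects the terms of the expansion in the basis by weight; uniqueness holds since
  the component of weight \<open>\<nu>\<close> can only involve the basis vector of weight \<open>\<nu>\<close>, with the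
  coefficient that it has in \<open>v\<close>.\<close>

lemma weight_decomposition:
  "\<exists>!f. (\<forall>\<nu>\<in>weight_lattice n. f \<nu> \<in> weight_space n t scale act \<nu>) \<and>
        (\<forall>\<nu>. \<nu> \<notin> weight_lattice n \<longrightarrow> f \<nu> = 0) \<and>
        finite {\<nu>. f \<nu> \<noteq> 0} \<and> v = (\<Sum>\<nu> | f \<nu> \<noteq> 0. f \<nu>)" (is "\<exists>!f. ?P f")
proof (rule ex_ex1I)
  define f where "f \<nu> = (\<Sum>m | m \<in> supp v \<and> wt m = \<nu>. scale (coef v m) (b m))" for \<nu>
  have sub: "{\<nu>. f \<nu> \<noteq> 0} \<subseteq> wt ` supp v"
  proof
    fix \<nu> assume \<nu>: "\<nu> \<in> {\<nu>. f \<nu> \<noteq> 0}"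
    show "\<nu> \<in> wt ` supp v"
    proof (rule ccontr)
      assume "\<nu> \<notin> wt ` supp v"
      then have empty: "{m. m \<in> supp v \<and> wt m = \<nu>} = {}" by blast
      have "f \<nu> = 0" unfolding f_def empty by simp
      with \<nu> show False by simp
    qed
  qed
  have "?P f"
  proof (intro conjI ballI allI impI)
    fix \<nu>
    have "b m \<in> weight_space n t scale act (wt m)" if "m \<in> crystal" for m
      using that by (simp add: weight_space_def basis_action)
    then show "f \<nu> \<in> weight_space n t scale act \<nu>"
      unfolding f_def by (auto intro!: subspace_sum[OF subspace_weight_space] subspace_scale[OF
          subspace_weight_space])
    show "f \<nu> = 0" if "\<nu> \<notin> weight_lattice n"
    proof -
      have "\<nu> \<notin> wt ` supp v" using that wt_in_lattice by auto
      then show ?thesis using sub by blast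
    qed
    show "finite {\<nu>. f \<nu> \<noteq> 0}"
      using sub finite_supp by (blast intro: finite_subset)
    have "v = (\<Sum>\<nu>\<in>wt ` supp v. f \<nu>)"
      unfolding f_def using expansion[of v] sum.image_gen[OF finite_supp, of
          "\<lambda>m. scale (coef v m) (b m)" v wt] by simp
    also have "\<dots> = (\<Sum>\<nu> | f \<nu> \<noteq> 0. f \<nu>)"
      using sub finite_supp by (intro sum.mono_neutral_right) auto
    finally show "v = (\<Sum>\<nu> | f \<nu> \<noteq> 0. f \<nu>)" .
  qed
  then show "\<exists>f. ?P f" by blast
next
  have coef_f: "coef (f \<nu>) m = (if wt m = \<nu> then coef v m else 0)"
    if f: "?P f" and \<nu>: "\<nu> \<in> weight_lattice n" and m: "m \<in> crystal" for f \<nu> m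
  proof -
    have zero: "coef (f \<mu>) m = 0" if "\<mu> \<noteq> wt m" for \<mu>
    proof (cases "\<mu> \<in> weight_lattice n")
      case True
      then show ?thesis using weight_space_coef[of "f \<mu>" \<mu> m] f m that by auto
    next
      case False
      then show ?thesis using f by (auto simp: coef_linear)
    qed
    have fin: "finite {\<mu>. f \<mu> \<noteq> 0}" and v: "v = (\<Sum>\<mu> | f \<mu> \<noteq> 0. f \<mu>)"
      using f by blast+
    have "coef v m = (\<Sum>\<mu> | f \<mu> \<noteq> 0. coef (f \<mu>) m)"
      by (subst v) (rule coef_linear(4))
    also have "\<dots> = (\<Sum>\<mu>\<in>{wt m}. coef (f \<mu>) m)"
      using fin zero by (intro sum.mono_neutral_cong) (auto simp: coef_linear)
    finally show ?thesis using zero by auto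
  qed
  fix f g assume f: "?P f" and g: "?P g"
  show "f = g"
  proof
    fix \<nu>
    show "f \<nu> = g \<nu>"
    proof (cases "\<nu> \<in> weight_lattice n")
      case True
      then show ?thesis using coef_f[OF f True] coef_f[OF g True] by (intro coef_eqI) simp
    next
      case False
      then show ?thesis using f g by auto
    qed
  qed
qed

lemma integrable: "integrable n t scale act"
  unfolding integrable_def
proof (intro conjI allI ballI)
  fix s i v assume "i \<in> {0..n}"
  then have "(rho (xx s i 0) ^^ 2) v = 0"
    using xx_square_zero[of i s v] by (simp add: numeral_2_eq_2)
  then show "\<exists>k. (rho (xx s i 0) ^^ k) v = 0" by blast
qed (rule weight_decomposition)

lemma cyclic: "{act a (b m0) | a. a \<in> carrier (qtor n t)} = UNIV"
proof -
  interpret R: ring "qtor n t" by (rule ring_qtor)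
  let ?U = "{act a (b m0) | a. a \<in> carrier (qtor n t)}"
  have sub: "subspace ?U"
    by (intro subspace_orbit) (auto intro: cls_closed con_in_carrier)
  have stable: "rho (xx s i 0) u \<in> ?U" if u: "u \<in> ?U" and i: "i \<in> {0..n}" for s i u
  proof -
    have X: "cls n t (xx s i 0) \<in> carrier (qtor n t)"
      using i by (intro cls_closed generators_in_carrier) auto
    obtain a where a: "a \<in> carrier (qtor n t)" "u = act a (b m0)" using u by blast
    then have "rho (xx s i 0) u = act (cls n t (xx s i 0) \<otimes>\<^bsub>qtor n t\<^esub> a) (b m0)"
      using X by (simp add: act_algebra)
    then show ?thesis using X a by blast
  qed
  have "b m \<in> ?U" if "m \<in> crystal" for m
    using that
  proof induction
    case start
    have "b m0 = act \<one>\<^bsub>qtor n t\<^esub> (b m0)" using rho_con[of 1 "b m0"] by (simp add: cls_one)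
    then show ?case using R.one_closed by blast
  next
    case (etil m i m')
    then have "b m' = rho (xx Pl i 0) (b m)" by (simp add: basis_action ovec_def)
    then show ?case using stable[of "b m" i] etil by simp
  next
    case (ftil m i m')
    then have "b m' = rho (xx Mi i 0) (b m)" by (simp add: basis_action ovec_def)
    then show ?case using stable[of "b m" i] ftil by simp
  qed
  then have "span (b ` crystal) \<subseteq> ?U"
    using sub by (intro span_minimal) auto
  then show ?thesis using basis by auto
qed

lemma basis_nonzero: "m \<in> crystal \<Longrightarrow> b m \<noteq> 0"
  using basis(2) dependent_zero[of "b ` crystal"] imageI[of m crystal b] by auto

lemma lweight_vector_basis:
  assumes "m \<in> crystal" "is_monomial n m"
  shows "lweight_vector n t scale act (b m) m"
proof -
  have "\<forall>s. \<forall>i\<in>{0..n}. \<forall>a::nat. ((\<lambda>u. rho (phi t s i (sg s * int a)) u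
      - scale (fps_nth (lweight_series t s i m) a) u) ^^ 1) (b m) = 0"
    using assms by (simp add: basis_action)
  moreover have "b m \<in> weight_space n t scale act (wt m)"
    using assms by (simp add: weight_space_def basis_action)
  ultimately show ?thesis
    unfolding lweight_vector_def using assms basis_nonzero by blast
qed

section \<open>Finiteness over the vertical subalgebras\<close>

text \<open>Induction on \<open>\<bar>k\<bar>\<close>: the elements of the free algebra that have \<open>v_m\<close> as an eigenvector form
  a subalgebra \<open>S\<close>, which contains the coefficients of \<open>\<phi>_i(z)\<close> and \<open>k\<close>, hence those of the
  exponential, and the latter differ from a multiple of \<open>h_{i,k}\<close> by polynomials in the \<open>h_{i,k'}\<close>
  with \<open>\<bar>k'\<bar> < \<bar>k\<bar>\<close>.\<close>

lemma hh_diagonal: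
  assumes m: "m \<in> crystal" and i: "i \<le> n" and k: "k \<noteq> 0"
  shows "\<exists>c. rho (hh i k) (b m) = scale c (b m)"
proof -
  define S where "S = {a \<in> free_elems. \<exists>c. rho a (b m) = scale c (b m)}"
  have S_con: "con c \<in> S" for c by (auto simp: S_def con_in_carrier rho_con)
  have S_add: "x + y \<in> S" if "x \<in> S" "y \<in> S" for x y
    using that by (auto simp: S_def free_algebra_closed rho_algebra simp flip: scale_left_distrib)
  have S_mult: "x * y \<in> S" if "x \<in> S" "y \<in> S" for x y
    using that by (auto simp: S_def free_algebra_closed rho_algebra act_linear[OF cls_closed])
  have S_step: "hh i (sg s * int j) \<in> S" if "j \<ge> 1" for s j
    using that
  proof (induction j rule: less_induct)
    case (less j)
    define \<kappa> where "\<kappa> = (sg s * (qpow t 1 - qpow t (- 1)) :: complex)"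
    define F where "F = Abs_fps (\<lambda>a. if a = 0 then 0 else con \<kappa> * hh i (sg s * int a))"
    define h where "h = (case s of Pl \<Rightarrow> hvec i | Mi \<Rightarrow> - hvec i)"
    have "\<kappa> \<noteq> 0"
      using sg_cases[of s, where ?'a = complex] qpow_eq_iff[OF generic, of 1 "- 1"]
      by (auto simp: \<kappa>_def)
    have h: "h \<in> cartan_space n" "- h \<in> cartan_space n"
      using hvec_in_cartan[OF i] by (auto simp: h_def split: pm.split)
    have hh_in: "hh i (sg s * int a) \<in> free_elems" if "a \<ge> 1" for a
      using i that sg_cases[of s, where ?'a = int] by (intro generators_in_carrier) auto
    have E: "exp_coeff F j \<in> free_elems"
      by (intro exp_coeff_in_set con_in_carrier free_algebra_closed)
        (auto simp: F_def hh_in Suc_leI intro!: free_algebra_closed con_in_carrier zero_one_in_carrier)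
    have phi: "phi t s i (sg s * int j) = kk h * exp_coeff F j"
      by (cases s) (simp_all add: phi_def h_def F_def \<kappa>_def cong: if_cong)
    \<comment> \<open>The factor \<open>k\<close> of \<open>\<phi>_i(z)\<close> is invertible and diagonal, so the exponential is diagonal as well.\<close>
    obtain c where "rho (kk h) (rho (exp_coeff F j) (b m)) = scale c (b m)"
      using basis_action(2)[OF m i, of s j] E h by (auto simp: phi rho_algebra generators_in_carrier)
    then have "rho (exp_coeff F j) (b m) = rho (kk (- h)) (scale c (b m))"
      using kk_inverse[OF h(1)] by metis
    also have "\<dots> = scale (c * qpow t (pairing (wt m) (- h))) (b m)"
      using h by (simp add: act_linear[OF cls_closed] generators_in_carrier basis_action[OF m])
    finally obtain c1 where c1: "rho (exp_coeff F j) (b m) = scale c1 (b m)" by blast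
    have "fps_nth F a \<in> S" if "a < j" for a
      using less.IH[of a] that S_con[of 0] by (auto simp: F_def con_simps intro!: S_mult S_con)
    then obtain c where c: "c \<in> S" "exp_coeff F j = fps_nth F j + c"
      using exp_coeff_leading[of S F j] S_con S_add S_mult less.prems by (auto simp: F_def)
    then obtain c2 where c2: "c \<in> free_elems" "rho c (b m) = scale c2 (b m)" by (auto simp: S_def)
    have Fj: "fps_nth F j = con \<kappa> * hh i (sg s * int j)" using less.prems by (simp add: F_def)
    have "scale \<kappa> (rho (hh i (sg s * int j)) (b m)) + scale c2 (b m) = scale c1 (b m)"
      using c1 c2 hh_in[OF less.prems] unfolding c(2) Fj
      by (simp add: rho_algebra free_algebra_closed con_in_carrier rho_con)
    then have "scale \<kappa> (rho (hh i (sg s * int j)) (b m)) = scale (c1 - c2) (b m)"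
      by (simp add: scale_left_diff_distrib eq_diff_eq)
    then have "scale (1 / \<kappa>) (scale \<kappa> (rho (hh i (sg s * int j)) (b m)))
        = scale (1 / \<kappa>) (scale (c1 - c2) (b m))"
      by simp
    then have "rho (hh i (sg s * int j)) (b m) = scale (1 / \<kappa> * (c1 - c2)) (b m)"
      using \<open>\<kappa> \<noteq> 0\<close> by simp
    then show ?case using hh_in[OF less.prems] unfolding S_def by blast
  qed
  obtain s where "k = sg s * int (nat \<bar>k\<bar>)"
    by (cases "k > 0") (auto intro: that[of Pl] that[of Mi])
  moreover have "nat \<bar>k\<bar> \<ge> 1" using k by simp
  ultimately show ?thesis using S_step[of "nat \<bar>k\<bar>" s] by (auto simp: S_def)
qed

text \<open>The basis vectors are eigenvectors of the \<open>k_h\<close> and \<open>h_{i,m}\<close>, and the \<open>x_{i,m}\<close> are built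
  from these and from the \<open>x_{i,0}\<close>, which follow arrows of colour \<open>i \<noteq> j\<close>.\<close>

lemma vertical_invariant:
  assumes K: "K \<subseteq> crystal"
    and closed: "\<And>m m' i. m \<in> K \<Longrightarrow> m' \<in> crystal \<Longrightarrow> i \<le> n \<Longrightarrow> i \<noteq> j \<Longrightarrow>
      wt m' = wt m + sroot n i \<or> wt m' = wt m - sroot n i \<Longrightarrow> m' \<in> K"
    and a: "a \<in> vertical n t j" and v: "v \<in> span (b ` K)"
  shows "act a v \<in> span (b ` K)"
  using a v unfolding vertical_def
proof (induction arbitrary: v)
  case (scalar c)
  then show ?case by (simp add: rho_con span_scale)
next
  case (add x y)
  then show ?case
    using subalgebra_closed[OF vertical_gens_closed] by (simp add: act_algebra span_add)
next
  case (mult x y)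
  then show ?case
    using subalgebra_closed[OF vertical_gens_closed] by (simp add: act_algebra)
next
  case (gener x)
  have h: "rho (hh i k) w \<in> span (b ` K)" if "i \<le> n" "k \<noteq> 0" "w \<in> span (b ` K)" for i k w
  proof (rule act_span[OF cls_closed[OF generators_in_carrier(3)] _ that(3)])
    fix y assume "y \<in> b ` K"
    then obtain m where "m \<in> K" "y = b m" by blast
    moreover obtain c where "rho (hh i k) (b m) = scale c (b m)"
      using hh_diagonal[of m i k] \<open>m \<in> K\<close> \<open>i \<le> n\<close> \<open>k \<noteq> 0\<close> K by blast
    ultimately show "rho (hh i k) y \<in> span (b ` K)"
      by (simp add: span_scale span_base)
  qed (use that in auto)
  have x0: "rho (xx s i 0) w \<in> span (b ` K)" if "i \<le> n" "i \<noteq> j" "w \<in> span (b ` K)" for s i w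
  proof (rule act_span[OF cls_closed[OF generators_in_carrier(1)] _ that(3)])
    fix y assume "y \<in> b ` K"
    then obtain m where m: "m \<in> K" "y = b m" by blast
    have "rho (xx s i 0) (b m) = 0 \<or> (\<exists>m'\<in>K. rho (xx s i 0) (b m) = b m')"
      using xx_basis[of m i s] closed[OF m(1) _ \<open>i \<le> n\<close> \<open>i \<noteq> j\<close>] \<open>i \<le> n\<close> m(1) K by blast
    then show "rho (xx s i 0) y \<in> span (b ` K)"
      unfolding m(2) by (auto simp: span_zero span_base)
  qed (use that in auto)
  from gener.hyps consider s i k where "x = cls n t (xx s i k)" "i \<le> n" "i \<noteq> j"
    | i k where "x = cls n t (hh i k)" "i \<le> n" "k \<noteq> 0"
    | h where "x = cls n t (kk h)" "h \<in> cartan_space n"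
    using cartan_spaceI by auto
  then show ?case
  proof cases
    case 1
    then show ?thesis using xx_span_invariant[OF generic, of i "b ` K" s v k] x0 h gener.prems by blast
  next
    case 2
    then show ?thesis using h gener.prems by blast
  next
    case 3
    have "rho (kk h) v \<in> span (b ` K)"
    proof (rule act_span[OF cls_closed[OF generators_in_carrier(2)] _ gener.prems])
      fix y assume "y \<in> b ` K"
      then obtain m where "m \<in> K" "y = b m" by blast
      then show "rho (kk h) y \<in> span (b ` K)"
        using 3 K basis_action(1)[of m h] by (auto simp: span_scale span_base)
    qed (rule 3)
    then show ?thesis using 3 by simp
  qed
qed

text \<open>The blocks of the finitely many monomials that occur in \<open>v\<close> span a finite-dimensional space
  that is stable under the vertical subalgebra.\<close>

lemma vertical_finite_dimensional:
  assumes j: "j \<le> n"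
  shows "\<exists>B. finite B \<and> {act a v | a. a \<in> vertical n t j} = span B"
proof -
  define K where "K = (\<Union>m\<in>supp v. colour_block n crystal j m)"
  have K: "K \<subseteq> crystal" by (auto simp: K_def colour_block_def)
  have finK: "finite K" unfolding K_def
    using finite_supp finite_colour_block[OF minuscule n j] by blast
  have "v \<in> span (b ` K)"
  proof -
    have "scale (coef v m) (b m) \<in> span (b ` K)" if "m \<in> supp v" for m
      using that colour_block_self[of m crystal n j] unfolding K_def
      by (intro span_scale span_base imageI) blast
    then have "(\<Sum>m\<in>supp v. scale (coef v m) (b m)) \<in> span (b ` K)" by (rule span_sum)
    then show ?thesis by (simp only: expansion)
  qed
  moreover have "m' \<in> K" if m: "m \<in> K" and "m' \<in> crystal" "i \<le> n" "i \<noteq> j"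
      "wt m' = wt m + sroot n i \<or> wt m' = wt m - sroot n i" for m m' i
  proof -
    obtain p where "p \<in> supp v" "m \<in> colour_block n crystal j p"
      using m unfolding K_def by blast
    then show ?thesis
      using colour_block_step[of m n crystal j p i m'] that(2-5) unfolding K_def by blast
  qed
  ultimately have inv: "act a v \<in> span (b ` K)" if "a \<in> vertical n t j" for a
    using vertical_invariant[OF K, of j a v] that by blast
  let ?U = "{act a v | a. a \<in> vertical n t j}"
  have sub: "subspace ?U"
    unfolding vertical_def
    by (rule subspace_subalgebra_orbit[OF vertical_gens_closed])
  obtain B where B: "B \<subseteq> ?U" "independent B" "?U \<subseteq> span B"
    by (rule maximal_independent_subset)
  have "B \<subseteq> span (b ` K)" using B(1) inv by blast
  then have "finite B"
    using independent_span_bound[OF finite_imageI[OF finK] B(2)] by blast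
  moreover have "?U = span B"
    using B span_minimal[OF B(1) sub] by blast
  ultimately show ?thesis by blast
qed

section \<open>Extremality\<close>

lemma divided_power_simps:
  assumes "A \<in> carrier (qtor n t)"
  shows "act (divided_power n t A 0) v = v" "act (divided_power n t A (Suc 0)) v = act A v"
proof -
  interpret R: ring "qtor n t" by (rule ring_qtor)
  have one: "act \<one>\<^bsub>qtor n t\<^esub> v = v" for v using rho_con[of 1 v] by (simp add: cls_one)
  have c: "cls n t (con c) \<in> carrier (qtor n t)" for c by (intro cls_closed con_in_carrier)
  show "act (divided_power n t A 0) v = v"
    using c by (simp add: divided_power_def act_algebra one rho_con)
  show "act (divided_power n t A (Suc 0)) v = act A v"
    using c assms by (simp add: divided_power_def act_algebra rho_con qint_1[OF generic])
qed

lemma lookup_sref: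
  "Poly_Mapping.lookup (sref n i \<mu>) c
    = Poly_Mapping.lookup \<mu> c - Poly_Mapping.lookup \<mu> (CH i) * Poly_Mapping.lookup (sroot n i) c"
  by (simp add: sref_def lookup_minus Poly_Mapping.map.rep_eq when_def)

text \<open>Strings have length at most one, so the divided powers that occur are the zeroth and the
  first, and they move the basis vector of weight \<open>\<mu>\<close> to that of weight \<open>s_i \<mu>\<close>.\<close>

lemma reflection_cases:
  assumes m: "m \<in> crystal" and i: "i \<le> n"
  obtains m' where "m' \<in> crystal" "wt m' = sref n i (wt m)"
    "pairing (wt m) (hvec i) \<ge> 0 \<longrightarrow> rho (xx Pl i 0) (b m) = 0 \<and>
      act (divided_power n t (cls n t (xx Mi i 0)) (nat \<lfloor>pairing (wt m) (hvec i)\<rfloor>)) (b m) = b m'"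
    "- pairing (wt m) (hvec i) \<ge> 0 \<longrightarrow> rho (xx Mi i 0) (b m) = 0 \<and>
      act (divided_power n t (cls n t (xx Pl i 0)) (nat \<lfloor>- pairing (wt m) (hvec i)\<rfloor>)) (b m) = b m'"
proof -
  note dp = divided_power_simps[OF cls_closed[OF generators_in_carrier(1)[OF i]]]
  have sref: "\<mu> = sref n i (wt m)"
    if "\<And>c. Poly_Mapping.lookup \<mu> c = Poly_Mapping.lookup (wt m) c
       - pairing (wt m) (hvec i) * Poly_Mapping.lookup (sroot n i) c" for \<mu>
    by (rule poly_mapping_eqI) (simp add: that lookup_sref)
  from m i show thesis
  proof (cases rule: string_cases)
    case 1
    then show thesis using m by (intro that[of m] sref) (simp_all add: dp)
  next
    case (2 m')
    then show thesis by (intro that[of m'] sref) (simp_all add: dp lookup_minus)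
  next
    case (3 m')
    then show thesis by (intro that[of m'] sref) (simp_all add: dp lookup_add)
  qed
qed

lemma weyl_orbit:
  assumes "w \<in> affine_weyl n"
  shows "\<exists>m\<in>crystal. wt m = w (wt m0)"
  using assms
proof induction
  case one
  show ?case by (auto intro: subcrystal.start)
next
  case (refl w i)
  then obtain m where m: "m \<in> crystal" "wt m = w (wt m0)" by blast
  from refl have "i \<le> n" by simp
  with m(1) obtain m' where "m' \<in> crystal" "wt m' = sref n i (wt m)" by (rule reflection_cases)
  then show ?case using m(2) by auto
qed

text \<open>The family is \<open>v_w\<close> = the basis vector of weight \<open>w \<lambda>\<close>. It is well defined because weights
  determine monomials.\<close>

lemma extremal: "extremal n t scale act (b m0)"
proof -
  define u where "u w = b (THE m. m \<in> crystal \<and> wt m = w (wt m0))" for w :: "cvec \<Rightarrow> cvec"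
  have u: "u w = b m" if "m \<in> crystal" "wt m = w (wt m0)" for w m
  proof -
    have "(THE m. m \<in> crystal \<and> wt m = w (wt m0)) = m"
      using that wt_inj by (intro the_equality) auto
    then show ?thesis by (simp add: u_def)
  qed
  have start: "m0 \<in> crystal" by (rule subcrystal.start)
  have "u id = b m0" using u[OF start, of id] by simp
  moreover have "(pairing (w (wt m0)) (hvec i) \<ge> 0 \<longrightarrow> rho (xx Pl i 0) (u w) = 0 \<and>
        act (divided_power n t (cls n t (xx Mi i 0)) (nat \<lfloor>pairing (w (wt m0)) (hvec i)\<rfloor>)) (u w)
            = u (sref n i \<circ> w)) \<and>
      (- pairing (w (wt m0)) (hvec i) \<ge> 0 \<longrightarrow> rho (xx Mi i 0) (u w) = 0 \<and>
        act (divided_power n t (cls n t (xx Pl i 0)) (nat \<lfloor>- pairing (w (wt m0)) (hvec i)\<rfloor>)) (u w)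
            = u (sref n i \<circ> w))"
    if w: "w \<in> affine_weyl n" and i: "i \<in> {0..n}" for w i
  proof -
    obtain m where m: "m \<in> crystal" "wt m = w (wt m0)" using weyl_orbit[OF w] by blast
    from i have "i \<le> n" by simp
    with m(1) obtain m' where m': "m' \<in> crystal" "wt m' = sref n i (wt m)"
      "pairing (wt m) (hvec i) \<ge> 0 \<longrightarrow> rho (xx Pl i 0) (b m) = 0 \<and>
        act (divided_power n t (cls n t (xx Mi i 0)) (nat \<lfloor>pairing (wt m) (hvec i)\<rfloor>)) (b m) = b m'"
      "- pairing (wt m) (hvec i) \<ge> 0 \<longrightarrow> rho (xx Mi i 0) (b m) = 0 \<and>
        act (divided_power n t (cls n t (xx Pl i 0)) (nat \<lfloor>- pairing (wt m) (hvec i)\<rfloor>)) (b m) = b m'"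
      by (rule reflection_cases)
    have "u w = b m" "u (sref n i \<circ> w) = b m'"
      using u[of m w, OF m] u[of m' "sref n i \<circ> w"] m(2) m' by simp_all
    then show ?thesis unfolding m(2)[symmetric] using m'(3,4) by simp
  qed
  moreover have "b m0 \<in> weight_space n t scale act (wt m0)"
    using start by (simp add: weight_space_def basis_action)
  ultimately show ?thesis
    unfolding extremal_def using wt_in_lattice[OF start] by blast
qed

end

section \<open>The fundamental modules\<close>

theorem theorem4p7:
  fixes n r l :: nat and t :: complex and s :: "nat \<Rightarrow> nat"
    and scale :: "complex \<Rightarrow> 'v \<Rightarrow> 'v::ab_group_add"
    and act :: "qtor_elem \<Rightarrow> 'v \<Rightarrow> 'v"
    and b :: "monomial \<Rightarrow> 'v"
  assumes "n = 2 * r + 1" and "r \<ge> 1"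
    and "l \<in> {1, r + 1, n}"
    and "\<forall>k::nat. k > 0 \<longrightarrow> exp t ^ k \<noteq> 1"
    and "parity_function n s" and "fund_monomial n l \<in> crystal_monomials n s"
    and "monomial_module n t scale act (fund_monomial n l) b"
  shows "extremal_loop_weight_module n t scale act (b (fund_monomial n l))
       \<and> lweight_vector n t scale act (b (fund_monomial n l)) (fund_monomial n l)"
proof -
  have module: "qtor_module n t scale act"
    using assms(7) by (simp add: monomial_module_def)
  then interpret vector_space scale by (simp add: qtor_module_def)
  interpret minuscule_module scale n t act "fund_monomial n l" b
    using assms module minuscule_fund_monomial[OF assms(1-3)] by unfold_locales auto
  have "lweight_vector n t scale act (b (fund_monomial n l)) (fund_monomial n l)"
    using assms(6) by (intro lweight_vector_basis subcrystal.start) (simp add: crystal_monomials_def)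
  then show ?thesis
    unfolding extremal_loop_weight_module_def
    using module integrable cyclic extremal vertical_finite_dimensional
    by (intro conjI exI[of _ "fund_monomial n l"] allI ballI) auto
qed

end
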